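(* Let $t\le 1$. If $$\mathbf Q(r,\theta,\varphi) = s(r,\theta,\varphi)\Bigl(\mathbf n(\theta,\varphi)\otimes \mathbf n(\theta,\varphi) - \tfrac13 \mathbf I\Bigr)$$ is a non-trivial uniaxial solution in $\mathbb R^3$ of the Euler–Lagrange equations $$\Delta \mathbf{Q}_{ij} = t\, \mathbf{Q}_{ij} - 3\sqrt{6}\Bigl( \mathbf{Q}_{ik}\mathbf{Q}_{kj} - \tfrac13 \delta_{ij}\,\mathrm{tr}(\mathbf{Q}^2)\Bigr) + 2\,\mathbf{Q}_{ij}\,\mathrm{tr}(\mathbf{Q}^2),\qquad i,j=1,2,3,$$ with $$\mathbf n(\theta,\varphi) = \bigl(\sin f(\varphi)\cos g(\theta),\ \sin f(\varphi)\sin g(\theta),\ \cos f(\varphi)\bigr),$$ then $$f(\varphi) = \pm\varphi,\qquad \frac{\mathrm d g}{\mathrm d\theta} = \pm 1,$$ and $s=s(r)$ satisfies $$s''(r) + \frac{2}{r}s'(r) = \frac{6}{r^2}s(r) + t s - \sqrt6\, s^2 + \frac43 s^3 .$$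
   Context: Spherical polar coordinates: $\mathbf x = (r\cos\theta\sin\varphi,\ r\sin\theta\sin\varphi,\ r\cos\varphi)$ with $0\le r<\infty$, $0\le\varphi\le\pi$, $0\le\theta<2\pi$. Here $\mathbf Q$ takes values in symmetric traceless real $3\times3$ matrices, repeated indices are summed, $\mathbf I$ is the $3\times 3$ identity, and solutions are classical. A uniaxial solution is a solution of the form $\mathbf Q = s(\mathbf n\otimes\mathbf n-\frac13\mathbf I)$ with a real-valued scalar order parameter $s$ and a unit-vector field $\mathbf n$ (the director). It is called trivial if the director is constant on every connected component of the region $\{\mathbf Q\ne0\}$ (in particular if $\mathbf Q\equiv0$), and non-trivial otherwise. The real number $t$ is the reduced temperature.
   Formalization: f and g are assumed continuous, and f(φ) = ±φ is proved only up to adding a fixed integer multiple of π: replacing f by f+π changes n to −n and leaves Q unchanged, so the literal claim fails (f = φ+π, g = θ for the hedgehog). *)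

theory Defs
  imports "HOL-Analysis.Analysis"
begin

definition partial_deriv :: "3 \<Rightarrow> (real^3 \<Rightarrow> real) \<Rightarrow> real^3 \<Rightarrow> real" where
  "partial_deriv k u x = frechet_derivative u (at x) (axis k 1)"

definition C1 :: "(real^3 \<Rightarrow> real) \<Rightarrow> bool" where
  "C1 u \<longleftrightarrow> (\<forall>x. u differentiable at x) \<and> (\<forall>k. continuous_on UNIV (partial_deriv k u))"

definition C2 :: "(real^3 \<Rightarrow> real) \<Rightarrow> bool" where
  "C2 u \<longleftrightarrow> C1 u \<and> (\<forall>k. C1 (partial_deriv k u))"

definition laplacian :: "(real^3 \<Rightarrow> real) \<Rightarrow> real^3 \<Rightarrow> real" where
  "laplacian u x = (\<Sum>k\<in>UNIV. partial_deriv k (partial_deriv k u) x)"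

definition tensor :: "real^3 \<Rightarrow> real^3 \<Rightarrow> real^3^3" where
  "tensor a b = (\<chi> i j. a $ i * b $ j)"

definition uniaxial :: "real \<Rightarrow> real^3 \<Rightarrow> real^3^3" where
  "uniaxial s n = s *\<^sub>R (tensor n n - (1/3) *\<^sub>R mat 1)"

definition EL_solution :: "real \<Rightarrow> (real^3 \<Rightarrow> real^3^3) \<Rightarrow> bool" where
  "EL_solution t Q \<longleftrightarrow>
     (\<forall>x. transpose (Q x) = Q x \<and> trace (Q x) = 0) \<and>
     (\<forall>i j. C2 (\<lambda>x. Q x $ i $ j)) \<and>
     (\<forall>x i j. laplacian (\<lambda>y. Q y $ i $ j) x =
        t * Q x $ i $ j
        - 3 * sqrt 6 * ((Q x ** Q x) $ i $ j - 1/3 * mat 1 $ i $ j * trace (Q x ** Q x))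
        + 2 * Q x $ i $ j * trace (Q x ** Q x))"

(* The director of a uniaxial field is determined only up to sign, and only where Q is nonzero;
   triviality is therefore a property of the field Q: its director can be chosen constant on
   each connected component of the set where Q is nonzero. *)
definition trivial_uniaxial :: "(real^3 \<Rightarrow> real^3^3) \<Rightarrow> bool" where
  "trivial_uniaxial Q \<longleftrightarrow>
     (\<exists>s n. (\<forall>x. norm (n x) = 1 \<and> Q x = uniaxial (s x) (n x)) \<and>
            (\<forall>C \<in> components {x. Q x \<noteq> 0}. n constant_on C))"

definition spherical :: "real \<Rightarrow> real \<Rightarrow> real \<Rightarrow> real^3" where
  "spherical r \<theta> \<phi> = vector [r * cos \<theta> * sin \<phi>, r * sin \<theta> * sin \<phi>, r * cos \<phi>]"

end

theory Submission
  imports Defs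
begin

text \<open>Where \<open>s \<noteq> 0\<close>, the Euler-Lagrange system for \<open>Q = s (n \<otimes> n - I/3)\<close> consists of five scalar
equations, one for each direction in the space of symmetric traceless tensors. They are separated by
testing \<open>Q\<close> with pairs from the orthonormal frame formed by \<open>n\<close> and its unit derivatives \<open>e\<close> (with
respect to the angle \<open>f\<close>) and \<open>h\<close> (with respect to the angle \<open>g\<close>). The right-hand side is a multiple
of \<open>n \<otimes> n - I/3\<close>, so the pairs \<open>(e, e)\<close> and \<open>(h, h)\<close> give the same right-hand side and the mixed
pairs give \<open>0\<close>; the pair \<open>(e, h)\<close> tests to \<open>0 = 0\<close>, because \<open>f\<close> and \<open>g\<close> vary in orthogonal
directions. With primes for \<open>d/d\<phi>\<close> on \<open>f\<close> and \<open>d/d\<theta>\<close> on \<open>g\<close>, this yields (lemma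
\<open>frame_equations\<close>)

  \<^item> \<open>f'\<^sup>2 sin\<^sup>2 \<phi> = g'\<^sup>2 sin\<^sup>2 f\<close>, as the difference of \<open>(e, e)\<close> and \<open>(h, h)\<close>;
  \<^item> \<open>s (f'' sin\<^sup>2 \<phi> + f' sin \<phi> cos \<phi> - g'\<^sup>2 sin f cos f) + 2 s\<^sub>\<phi> f' sin\<^sup>2 \<phi> = 0\<close>, from \<open>(n, e)\<close>;
  \<^item> \<open>sin f (s g'' + 2 s\<^sub>\<theta> g') = 0\<close>, from \<open>(n, h)\<close>;
  \<^item> a second-order equation for \<open>s\<close> with source \<open>6 s f'\<^sup>2\<close>, from \<open>(e, e)\<close>.

The first equation says that the director is a conformal map of the sphere. Its variables separate, so
\<open>g'\<^sup>2\<close> is a constant \<open>C\<close>. If \<open>C = 0\<close>, the director is locally constant. If \<open>C \<noteq> 0\<close>, then \<open>g'' = 0\<close>,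
and differentiating the first equation shows that the bracket in the second one vanishes; hence
\<open>s\<^sub>\<phi> = s\<^sub>\<theta> = 0\<close> and \<open>s\<close> depends on \<open>r\<close> only. In the last equation everything but \<open>f'\<^sup>2\<close> is then
independent of \<open>\<phi>\<close>, so \<open>f'\<close> is constant, and comparing \<open>f'\<^sup>2 sin\<^sup>2 \<phi> = C sin\<^sup>2 f\<close> with its derivatives
leaves only \<open>f'\<^sup>2 = 1\<close> and \<open>C = 1\<close>. The alternative between \<open>C = 0\<close> and this rigid case is lemma \<open>box_dichotomy\<close>.

Both alternatives are local and hold only where \<open>s \<noteq> 0\<close>; two connectedness arguments make them global.
On a sphere of radius \<open>r\<close> the second alternative is an open and closed condition: \<open>s(r, \<cdot>)\<close> keeps its
nonzero value up to the boundary of the set where it holds, so this set cannot end inside the coordinate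
rectangle (\<open>rigid_everywhere\<close>). If the second alternative occurs nowhere, \<open>n \<otimes> n\<close> is locally
constant wherever \<open>Q \<noteq> 0\<close>, and \<open>Q\<close> is trivial (\<open>trivial_if_not_rigid\<close>). So a non-trivial solution has
the hedgehog director on one sphere; as the director does not depend on \<open>r\<close>, it has it on all of them,
and the \<open>(e, e)\<close> equation becomes the stated radial equation.\<close>

section \<open>Functions of one variable with a second derivative at a point\<close>

text \<open>The equations below involve first and second derivatives along coordinate lines at a single point. A
relation carries the existence of these derivatives together with their values, whereas \<open>deriv (deriv h) x\<close>
has a value even if the derivatives do not exist.\<close>

definition jet2 :: "(real \<Rightarrow> real) \<Rightarrow> real \<Rightarrow> real \<Rightarrow> real \<Rightarrow> bool" where
  "jet2 h x b c \<longleftrightarrow>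
     (\<exists>h'. (\<forall>\<^sub>F y in nhds x. (h has_real_derivative h' y) (at y)) \<and>
           h' x = b \<and> (h' has_real_derivative c) (at x))"

lemma jet2D: "jet2 h x b c \<Longrightarrow> (h has_real_derivative b) (at x)"
  unfolding jet2_def using eventually_nhds_x_imp_x by blast

lemma jet2_isCont: "jet2 h x b c \<Longrightarrow> isCont h x"
  using jet2D DERIV_isCont by blast

lemma jet2_deriv:
  assumes "jet2 h x b c"
  shows "deriv h x = b" "(deriv h has_real_derivative c) (at x)"
proof -
  obtain h' where h: "\<forall>\<^sub>F y in nhds x. (h has_real_derivative h' y) (at y)"
    and b: "h' x = b" and c: "(h' has_real_derivative c) (at x)"
    using assms unfolding jet2_def by blast
  have "\<forall>\<^sub>F y in nhds x. deriv h y = h' y"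
    using h by eventually_elim (rule DERIV_imp_deriv)
  then show "(deriv h has_real_derivative c) (at x)"
    using c DERIV_cong_ev by blast
  show "deriv h x = b"
    using assms jet2D DERIV_imp_deriv by blast
qed

lemma jet2_unique:
  assumes "jet2 h x b c" "jet2 h x b' c'"
  shows "b = b'" "c = c'"
  using jet2_deriv[OF assms(1)] jet2_deriv[OF assms(2)] DERIV_unique by blast+

lemma jet2_cong:
  assumes "jet2 h x b c" "\<forall>\<^sub>F y in nhds x. k y = h y"
  shows "jet2 k x b c"
proof -
  obtain h' where h: "\<forall>\<^sub>F y in nhds x. (h has_real_derivative h' y) (at y)"
    and b: "h' x = b" and c: "(h' has_real_derivative c) (at x)"
    using assms unfolding jet2_def by blast
  have "\<forall>\<^sub>F y in nhds x. \<forall>\<^sub>F z in nhds y. k z = h z"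
    using assms(2) eventually_eventually by auto
  then have "\<forall>\<^sub>F y in nhds x. (k has_real_derivative h' y) (at y)"
    using h by eventually_elim (use DERIV_cong_ev in blast)
  then show ?thesis using b c unfolding jet2_def by blast
qed

lemma jet2_const: "jet2 (\<lambda>y. k) x 0 0"
  unfolding jet2_def by (intro exI[of _ "\<lambda>y. 0"]) auto

lemma jet2_add:
  assumes "jet2 h x b c" "jet2 k x b' c'"
  shows "jet2 (\<lambda>y. h y + k y) x (b + b') (c + c')"
proof -
  obtain h' where h: "\<forall>\<^sub>F y in nhds x. (h has_real_derivative h' y) (at y)"
    and "h' x = b" and "(h' has_real_derivative c) (at x)"
    using assms(1) unfolding jet2_def by blast
  moreover obtain k' where k: "\<forall>\<^sub>F y in nhds x. (k has_real_derivative k' y) (at y)"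
    and "k' x = b'" and "(k' has_real_derivative c') (at x)"
    using assms(2) unfolding jet2_def by blast
  moreover have "\<forall>\<^sub>F y in nhds x. ((\<lambda>y. h y + k y) has_real_derivative h' y + k' y) (at y)"
    using h k by eventually_elim (rule DERIV_add)
  ultimately show ?thesis
    unfolding jet2_def by (intro exI[of _ "\<lambda>y. h' y + k' y"]) (auto intro: DERIV_add)
qed

lemma jet2_mult:
  assumes "jet2 h x b c" "jet2 k x b' c'"
  shows "jet2 (\<lambda>y. h y * k y) x (b * k x + h x * b') (c * k x + 2 * b * b' + h x * c')"
proof -
  obtain h' where h: "\<forall>\<^sub>F y in nhds x. (h has_real_derivative h' y) (at y)"
    and h1: "h' x = b" and h2: "(h' has_real_derivative c) (at x)"
    using assms(1) unfolding jet2_def by blast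
  obtain k' where k: "\<forall>\<^sub>F y in nhds x. (k has_real_derivative k' y) (at y)"
    and k1: "k' x = b'" and k2: "(k' has_real_derivative c') (at x)"
    using assms(2) unfolding jet2_def by blast
  have "\<forall>\<^sub>F y in nhds x. ((\<lambda>y. h y * k y) has_real_derivative h' y * k y + h y * k' y) (at y)"
    using h k by eventually_elim (auto intro!: derivative_eq_intros)
  moreover have "((\<lambda>y. h' y * k y + h y * k' y) has_real_derivative
      c * k x + 2 * b * b' + h x * c') (at x)"
    by (rule DERIV_cong[OF DERIV_add[OF DERIV_mult[OF h2 jet2D[OF assms(2)]]
          DERIV_mult[OF jet2D[OF assms(1)] k2]]]) (simp add: h1 k1)
  ultimately show ?thesis
    unfolding jet2_def using h1 k1
    by (intro exI[of _ "\<lambda>y. h' y * k y + h y * k' y"]) auto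
qed

lemma jet2_compose:
  assumes "jet2 h x b c" "jet2 \<psi> (h x) b' c'"
  shows "jet2 (\<lambda>y. \<psi> (h y)) x (b' * b) (c' * b\<^sup>2 + b' * c)"
proof -
  obtain h' where h: "\<forall>\<^sub>F y in nhds x. (h has_real_derivative h' y) (at y)"
    and h1: "h' x = b" and h2: "(h' has_real_derivative c) (at x)"
    using assms(1) unfolding jet2_def by blast
  obtain k where k: "\<forall>\<^sub>F y in nhds (h x). (\<psi> has_real_derivative k y) (at y)"
    and k1: "k (h x) = b'" and k2: "(k has_real_derivative c') (at (h x))"
    using assms(2) unfolding jet2_def by blast
  have "filterlim h (nhds (h x)) (nhds x)"
    using jet2_isCont[OF assms(1)] by (simp add: isCont_def tendsto_at_iff_tendsto_nhds)
  then have "\<forall>\<^sub>F y in nhds x. (\<psi> has_real_derivative k (h y)) (at (h y))"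
    using k eventually_compose_filterlim by blast
  then have "\<forall>\<^sub>F y in nhds x. ((\<lambda>y. \<psi> (h y)) has_real_derivative k (h y) * h' y) (at y)"
    using h by eventually_elim (rule DERIV_chain2)
  moreover have "((\<lambda>y. k (h y) * h' y) has_real_derivative c' * b\<^sup>2 + b' * c) (at x)"
    by (rule DERIV_cong[OF DERIV_mult[OF DERIV_chain2[where g = h, OF k2 jet2D[OF assms(1)]] h2]])
       (simp add: h1 k1 power2_eq_square)
  ultimately show ?thesis
    unfolding jet2_def using h1 k1
    by (intro exI[of _ "\<lambda>y. k (h y) * h' y"]) auto
qed

lemma jet2I:
  assumes "open J" "x \<in> J" "\<And>y. y \<in> J \<Longrightarrow> (h has_real_derivative h1 y) (at y)"
    and "(h1 has_real_derivative c) (at x)"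
  shows "jet2 h x (h1 x) c"
  unfolding jet2_def using assms eventually_nhds by blast

lemma jet2_familyD:
  assumes "open J" "x \<in> J" "\<And>y. y \<in> J \<Longrightarrow> jet2 h y (h1 y) (h2 y)"
  shows "(h1 has_real_derivative h2 x) (at x)"
proof -
  have "\<forall>\<^sub>F y in nhds x. deriv h y = h1 y"
    unfolding eventually_nhds using assms jet2_deriv(1)[OF assms(3)] by blast
  then show ?thesis
    using jet2_deriv(2)[OF assms(3)[OF assms(2)]] DERIV_cong_ev[OF refl _ refl] by blast
qed

lemma jet2_sin: "jet2 sin x (cos x) (- sin x)"
  by (rule jet2I[of UNIV _ _ cos]) (auto intro!: derivative_eq_intros)

lemma jet2_cos: "jet2 cos x (- sin x) (- cos x)"
  by (rule jet2I[of UNIV _ _ "\<lambda>x. - sin x"]) (auto intro!: derivative_eq_intros)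

lemma jet2_cmult:
  assumes "jet2 h x b c" shows "jet2 (\<lambda>y. k * h y) x (k * b) (k * c)"
  using jet2_mult[OF jet2_const[of k] assms] by simp

definition twice :: "(real \<Rightarrow> real) \<Rightarrow> real \<Rightarrow> bool" where
  "twice h x \<longleftrightarrow> (\<exists>b c. jet2 h x b c)"

lemma twice_const: "twice (\<lambda>y. k) x"
  using jet2_const unfolding twice_def by blast
lemma twice_add: "twice h x \<Longrightarrow> twice k x \<Longrightarrow> twice (\<lambda>y. h y + k y) x"
  using jet2_add unfolding twice_def by blast
lemma twice_mult: "twice h x \<Longrightarrow> twice k x \<Longrightarrow> twice (\<lambda>y. h y * k y) x"
  using jet2_mult unfolding twice_def by blast
lemma twice_sum:
  "finite I \<Longrightarrow> (\<And>i. i \<in> I \<Longrightarrow> twice (h i) x) \<Longrightarrow> twice (\<lambda>y. \<Sum>i\<in>I. h i y) x"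
  by (induction I rule: finite_induct) (auto intro: twice_const twice_add)
lemma twice_cong: "twice h x \<Longrightarrow> \<forall>\<^sub>F y in nhds x. k y = h y \<Longrightarrow> twice k x"
  using jet2_cong unfolding twice_def by blast

lemma twice_divide:
  assumes "twice h x" "twice k x" "k x \<noteq> 0"
  shows "twice (\<lambda>y. h y / k y) x"
proof -
  have "jet2 inverse (k x) (- 1 / (k x)\<^sup>2) (2 / (k x)^3)"
    by (rule jet2I[of "- {0}" _ _ "\<lambda>y. - 1 / y\<^sup>2"])
       (use assms(3) in \<open>auto intro!: derivative_eq_intros simp: field_simps power2_eq_square power3_eq_cube\<close>)
  then have "twice (\<lambda>y. inverse (k y)) x"
    using assms(2) jet2_compose unfolding twice_def by blast
  then show ?thesis
    using twice_mult[OF assms(1)] by (simp add: divide_inverse)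
qed

text \<open>Near \<open>x\<close> the continuous function \<open>F\<close> is recovered from \<open>cos F\<close> and \<open>sin F\<close> by
\<open>F y = F x + arcsin (sin (F y - F x))\<close>; continuity keeps \<open>F y - F x\<close> on the branch where this holds.\<close>

lemma DERIV_angle:
  fixes F :: "real \<Rightarrow> real"
  assumes "isCont F x" "((\<lambda>y. cos (F y)) has_real_derivative c) (at x)"
    "((\<lambda>y. sin (F y)) has_real_derivative d) (at x)"
  shows "(F has_real_derivative d * cos (F x) - c * sin (F x)) (at x)"
proof -
  let ?h = "\<lambda>y. sin (F y) * cos (F x) - cos (F y) * sin (F x)"
  have "(?h has_real_derivative d * cos (F x) - c * sin (F x)) (at x)"
    by (rule DERIV_cong[OF DERIV_diff[OF DERIV_cmult_right[OF assms(3)] DERIV_cmult_right[OF assms(2)]]]) simp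
  then have d: "((\<lambda>y. F x + arcsin (?h y)) has_real_derivative d * cos (F x) - c * sin (F x)) (at x)"
    using DERIV_chain2[OF DERIV_arcsin, of ?h x "d * cos (F x) - c * sin (F x)" UNIV]
    by (intro DERIV_cong[OF DERIV_add[OF DERIV_const]]) (auto simp: mult.commute)
  have "filterlim F (nhds (F x)) (nhds x)"
    using assms(1) by (simp add: isCont_def tendsto_at_iff_tendsto_nhds)
  then have "\<forall>\<^sub>F y in nhds x. dist (F y) (F x) < pi / 2"
    using pi_half_gt_zero unfolding tendsto_iff by blast
  then have "\<forall>\<^sub>F y in nhds x. F y = F x + arcsin (?h y)"
  proof eventually_elim
    case (elim y)
    then have "arcsin (sin (F y - F x)) = F y - F x"
      unfolding dist_real_def by (intro arcsin_sin) linarith+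
    then show ?case by (simp add: sin_diff)
  qed
  from DERIV_cong_ev[OF refl this refl] d show ?thesis by simp
qed

lemma twice_angle:
  assumes "open J" "x \<in> J" "continuous_on J F"
    and "twice (\<lambda>y. cos (F y)) x" "twice (\<lambda>y. sin (F y)) x"
  shows "twice F x"
proof -
  obtain c c2 where c: "jet2 (\<lambda>y. cos (F y)) x c c2" using assms(4) twice_def by blast
  obtain d d2 where d: "jet2 (\<lambda>y. sin (F y)) x d d2" using assms(5) twice_def by blast
  obtain c' where c1: "\<forall>\<^sub>F y in nhds x. ((\<lambda>y. cos (F y)) has_real_derivative c' y) (at y)"
    and c2: "(c' has_real_derivative c2) (at x)"
    using c unfolding jet2_def by blast
  obtain d' where d1: "\<forall>\<^sub>F y in nhds x. ((\<lambda>y. sin (F y)) has_real_derivative d' y) (at y)"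
    and d2: "(d' has_real_derivative d2) (at x)"
    using d unfolding jet2_def by blast
  have "\<forall>\<^sub>F y in nhds x. y \<in> J"
    using assms eventually_nhds by blast
  with c1 d1 have "\<forall>\<^sub>F y in nhds x. (F has_real_derivative d' y * cos (F y) - c' y * sin (F y)) (at y)"
  proof eventually_elim
    case (elim y)
    then have "isCont F y" using assms(1,3) continuous_on_eq_continuous_at by blast
    then show ?case using elim DERIV_angle by blast
  qed
  moreover have "((\<lambda>y. d' y * cos (F y) - c' y * sin (F y)) has_real_derivative
      (d2 * cos (F x) + d' x * c) - (c2 * sin (F x) + c' x * d)) (at x)"
    by (rule DERIV_cong[OF DERIV_diff[OF DERIV_mult[OF d2 jet2D[OF c]]
          DERIV_mult[OF c2 jet2D[OF d]]]]) simp
  ultimately show ?thesis unfolding twice_def jet2_def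
    by (intro exI[of _ "\<lambda>y. d' y * cos (F y) - c' y * sin (F y)"] exI conjI) auto
qed

lemma twice_jet2: "twice h x \<Longrightarrow> jet2 h x (deriv h x) (deriv (deriv h) x)"
  unfolding twice_def using jet2_deriv DERIV_imp_deriv by blast

lemma twice_eventually_nonzero:
  assumes "twice h x" "h x \<noteq> 0"
  shows "\<forall>\<^sub>F y in nhds x. h y \<noteq> 0"
proof -
  have "isCont h x" using assms(1) jet2_isCont twice_def by blast
  then have "filterlim h (nhds (h x)) (nhds x)"
    by (simp add: isCont_def tendsto_at_iff_tendsto_nhds)
  then show ?thesis
    using topological_tendstoD[of h "h x" "nhds x" "- {0}"] assms(2) by auto
qed

text \<open>The tensor \<open>n \<otimes> n\<close> determines the angles of \<open>n\<close> only up to the sign of \<open>n\<close>, that is, through the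
functions \<open>cos\<^sup>2\<close> and \<open>sin * cos\<close>. These are the cosine and sine of the doubled angle, which suffices
for a continuous angle to inherit their regularity.\<close>

lemma twice_half_angle:
  assumes "open J" "x \<in> J" "continuous_on J F"
    and "twice (\<lambda>y. (cos (F y))\<^sup>2) x" "twice (\<lambda>y. sin (F y) * cos (F y)) x"
  shows "twice F x"
proof -
  have c: "cos (2 * F y) = 2 * (cos (F y))\<^sup>2 + (- 1)" for y by (simp add: cos_double_cos)
  have s: "sin (2 * F y) = 2 * (sin (F y) * cos (F y))" for y by (simp add: sin_double)
  have "twice (\<lambda>y. 2 * F y) x"
    by (rule twice_angle[OF assms(1,2)])
       (auto simp only: c s intro!: twice_add twice_mult twice_const assms continuous_intros)
  from twice_mult[OF twice_const[of "1 / 2"] this] show ?thesis by simp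
qed

lemma eq_on_open_deriv:
  fixes u v :: "real \<Rightarrow> real"
  assumes "open J" "x \<in> J" "\<And>y. y \<in> J \<Longrightarrow> u y = v y"
    and "(u has_real_derivative d) (at x)" "(v has_real_derivative e) (at x)"
  shows "d = e"
proof -
  have "\<forall>\<^sub>F y in nhds x. u y = v y"
    using assms(1-3) eventually_nhds by blast
  from DERIV_cong_ev[OF refl this refl] assms(4) have "(v has_real_derivative d) (at x)" by simp
  then show ?thesis using assms(5) DERIV_unique by blast
qed

lemma zero_deriv_interval_constant:
  fixes u :: "real \<Rightarrow> real"
  assumes "\<And>x. x \<in> {a<..<b} \<Longrightarrow> (u has_real_derivative 0) (at x)"
    and "x \<in> {a<..<b}" "y \<in> {a<..<b}"
  shows "u x = u y"
proof -
  have "\<exists>c. \<forall>x\<in>{a<..<b}. u x = c"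
    by (rule has_field_derivative_zero_constant)
       (auto intro!: has_field_derivative_at_within[OF assms(1)])
  then show ?thesis using assms by metis
qed

text \<open>The slope may differ from point to point in the assumption; it is constant because the second derivative
vanishes.\<close>

lemma affine_if_jet_unit_slope:
  assumes "a < b" and jet: "\<And>x. x \<in> {a<..<b} \<Longrightarrow> \<exists>\<kappa>. \<kappa>\<^sup>2 = 1 \<and> jet2 h x \<kappa> 0"
  obtains \<kappa> c :: real where "\<kappa> = 1 \<or> \<kappa> = - 1" "\<And>x. x \<in> {a<..<b} \<Longrightarrow> h x = \<kappa> * x + c"
proof -
  obtain x\<^sub>0 where x0: "x\<^sub>0 \<in> {a<..<b}" using dense[OF assms(1)] by auto
  have d: "(deriv h has_real_derivative 0) (at x)" "(deriv h x)\<^sup>2 = 1" "(h has_real_derivative deriv h x) (at x)"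
    if "x \<in> {a<..<b}" for x
  proof -
    obtain \<kappa> where \<kappa>: "\<kappa>\<^sup>2 = 1" "jet2 h x \<kappa> 0" using jet[OF \<open>x \<in> {a<..<b}\<close>] by blast
    then show "(deriv h has_real_derivative 0) (at x)" "(deriv h x)\<^sup>2 = 1" "(h has_real_derivative deriv h x) (at x)"
      using jet2_deriv[OF \<kappa>(2)] jet2D[OF \<kappa>(2)] by simp_all
  qed
  define \<kappa> where "\<kappa> = deriv h x\<^sub>0"
  have \<kappa>: "deriv h x = \<kappa>" if "x \<in> {a<..<b}" for x
    unfolding \<kappa>_def using zero_deriv_interval_constant[OF d(1) that x0] .
  have "((\<lambda>x. h x - \<kappa> * x) has_real_derivative 0) (at x)" if "x \<in> {a<..<b}" for x
    using d(3)[OF that] \<kappa>[OF that] by (auto intro!: derivative_eq_intros)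
  from zero_deriv_interval_constant[OF this _ x0]
  have "h x = \<kappa> * x + (h x\<^sub>0 - \<kappa> * x\<^sub>0)" if "x \<in> {a<..<b}" for x
    using that by (simp add: algebra_simps)
  moreover have "\<kappa> = 1 \<or> \<kappa> = - 1" using d(2)[OF x0] by (simp add: \<kappa>_def power2_eq_1_iff)
  ultimately show ?thesis using that by blast
qed

section \<open>The Laplacian along the spherical coordinate lines\<close>

lemma frechet_partial_sum:
  fixes u :: "real^3 \<Rightarrow> real"
  assumes "u differentiable at x"
  shows "frechet_derivative u (at x) v = (\<Sum>k\<in>UNIV. partial_deriv k u x * v $ k)"
proof -
  interpret linear "frechet_derivative u (at x)"
    using assms by (rule linear_frechet_derivative)
  have "frechet_derivative u (at x) v = frechet_derivative u (at x) (\<Sum>k\<in>UNIV. v $ k *\<^sub>R axis k 1)"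
    by (simp add: basis_expansion[of v, unfolded scalar_mult_eq_scaleR])
  then show ?thesis by (simp add: sum scale partial_deriv_def mult.commute)
qed

lemma DERIV_along_curve:
  fixes u :: "real^3 \<Rightarrow> real" and \<gamma> :: "real \<Rightarrow> real^3"
  assumes "C1 u" "\<And>k. ((\<lambda>\<tau>. \<gamma> \<tau> $ k) has_real_derivative b k) (at \<tau>)"
  shows "((\<lambda>\<tau>. u (\<gamma> \<tau>)) has_real_derivative (\<Sum>k\<in>UNIV. partial_deriv k u (\<gamma> \<tau>) * b k)) (at \<tau>)"
proof -
  have u: "u differentiable at (\<gamma> \<tau>)" using assms(1) C1_def by blast
  have "(\<gamma> has_derivative (\<lambda>h. \<chi> k. b k * h)) (at \<tau>)"
    unfolding has_derivative_componentwise_within[where f = \<gamma>]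
  proof
    fix e :: "real^3" assume "e \<in> Basis"
    then obtain k where e: "e = axis k 1" by (auto simp: Basis_vec_def)
    show "((\<lambda>x. \<gamma> x \<bullet> e) has_derivative (\<lambda>x. (\<chi> k. b k * x) \<bullet> e)) (at \<tau>)"
      using assms(2)[of k] unfolding has_field_derivative_def e
      by (simp add: inner_axis)
  qed
  from diff_chain_at[OF this frechet_derivative_works[THEN iffD1, OF u], unfolded o_def]
  show ?thesis
    unfolding has_field_derivative_def
    by (rule has_derivative_eq_rhs) (auto simp: fun_eq_iff o_def frechet_partial_sum[OF u] sum_distrib_right mult.assoc)
qed

lemma jet2_along_curve:
  fixes u :: "real^3 \<Rightarrow> real" and \<gamma> :: "real \<Rightarrow> real^3"
  assumes "C2 u" "\<And>k. jet2 (\<lambda>\<tau>. \<gamma> \<tau> $ k) \<tau> (b k) (c k)"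
  shows "jet2 (\<lambda>\<tau>. u (\<gamma> \<tau>)) \<tau> (\<Sum>k\<in>UNIV. partial_deriv k u (\<gamma> \<tau>) * b k)
    (\<Sum>k\<in>UNIV. (\<Sum>l\<in>UNIV. partial_deriv l (partial_deriv k u) (\<gamma> \<tau>) * b l) * b k
                + partial_deriv k u (\<gamma> \<tau>) * c k)"
proof -
  have "\<exists>b'. (\<forall>\<^sub>F y in nhds \<tau>. ((\<lambda>\<tau>. \<gamma> \<tau> $ k) has_real_derivative b' y) (at y)) \<and>
     b' \<tau> = b k \<and> (b' has_real_derivative c k) (at \<tau>)" for k
    using assms(2) jet2_def by blast
  then obtain b' where b': "\<And>k. \<forall>\<^sub>F y in nhds \<tau>. ((\<lambda>\<tau>. \<gamma> \<tau> $ k) has_real_derivative b' k y) (at y)"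
    and b: "\<And>k. b' k \<tau> = b k" and c: "\<And>k. (b' k has_real_derivative c k) (at \<tau>)" by metis
  have "\<forall>\<^sub>F y in nhds \<tau>. \<forall>k. ((\<lambda>\<tau>. \<gamma> \<tau> $ k) has_real_derivative b' k y) (at y)"
    using b' by (simp add: eventually_all_finite)
  then have 1: "\<forall>\<^sub>F y in nhds \<tau>. ((\<lambda>\<tau>. u (\<gamma> \<tau>)) has_real_derivative
      (\<Sum>k\<in>UNIV. partial_deriv k u (\<gamma> y) * b' k y)) (at y)"
    by eventually_elim (use assms(1) C2_def in \<open>auto intro: DERIV_along_curve\<close>)
  have d: "((\<lambda>\<tau>. partial_deriv k u (\<gamma> \<tau>)) has_real_derivative
      (\<Sum>l\<in>UNIV. partial_deriv l (partial_deriv k u) (\<gamma> \<tau>) * b l)) (at \<tau>)" for k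
    using assms C2_def jet2D by (intro DERIV_along_curve) blast+
  have "((\<lambda>y. \<Sum>k\<in>UNIV. partial_deriv k u (\<gamma> y) * b' k y) has_real_derivative
     (\<Sum>k\<in>UNIV. (\<Sum>l\<in>UNIV. partial_deriv l (partial_deriv k u) (\<gamma> \<tau>) * b l) * b k
                + partial_deriv k u (\<gamma> \<tau>) * c k)) (at \<tau>)"
    by (rule DERIV_sum, rule DERIV_cong[OF DERIV_mult[OF d c]]) (simp add: b mult.commute)
  with 1 show ?thesis unfolding jet2_def
    by (intro exI[of _ "\<lambda>y. \<Sum>k\<in>UNIV. partial_deriv k u (\<gamma> y) * b' k y"]) (simp add: b)
qed

lemma spherical_nth:
  "spherical r \<theta> \<phi> $ 1 = r * cos \<theta> * sin \<phi>"
  "spherical r \<theta> \<phi> $ 2 = r * sin \<theta> * sin \<phi>"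
  "spherical r \<theta> \<phi> $ 3 = r * cos \<phi>"
  by (simp_all add: spherical_def)

text \<open>The formula \<open>\<Delta>u = u\<^sub>r\<^sub>r + (2/r) u\<^sub>r + (u\<^sub>\<phi>\<^sub>\<phi> + cot \<phi> u\<^sub>\<phi> + u\<^sub>\<theta>\<^sub>\<theta> / sin\<^sup>2 \<phi>) / r\<^sup>2\<close>, multiplied by
\<open>r\<^sup>2 sin\<^sup>2 \<phi>\<close>. The letters \<open>a\<close>, \<open>b\<close>, \<open>c\<close> stand for derivatives in \<open>r\<close>, \<open>\<theta>\<close>, \<open>\<phi>\<close>. As a relation
between \<open>u\<close> and the value \<open>L\<close> it is linear, so it passes from the entries of a matrix field to all linear
combinations of them.\<close>

definition polar_laplace :: "(real^3 \<Rightarrow> real) \<Rightarrow> real \<Rightarrow> real \<Rightarrow> real \<Rightarrow> real \<Rightarrow> bool" where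
  "polar_laplace u r \<theta> \<phi> L \<longleftrightarrow> (\<exists>a1 a2 b1 b2 c1 c2.
    jet2 (\<lambda>\<rho>. u (spherical \<rho> \<theta> \<phi>)) r a1 a2 \<and>
    jet2 (\<lambda>\<theta>. u (spherical r \<theta> \<phi>)) \<theta> b1 b2 \<and>
    jet2 (\<lambda>\<phi>. u (spherical r \<theta> \<phi>)) \<phi> c1 c2 \<and>
    r\<^sup>2 * (sin \<phi>)\<^sup>2 * L =
      (sin \<phi>)\<^sup>2 * (r\<^sup>2 * a2 + 2 * r * a1 + c2) + sin \<phi> * cos \<phi> * c1 + b2)"

text \<open>The second derivative of \<open>u\<close> along a curve \<open>c\<close> is \<open>D\<^sup>2u(c', c') + Du(c'')\<close>. The velocities of the three
coordinate lines are multiples of an orthonormal frame, so the weighted sum of the \<open>D\<^sup>2u\<close> terms is a trace,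
and the first-order terms of the formula cancel the contributions of the accelerations.\<close>

lemma polar_laplace_C2:
  assumes "C2 u"
  shows "polar_laplace u r \<theta> \<phi> (laplacian u (spherical r \<theta> \<phi>))"
proof -
  define p where "p k = partial_deriv k u (spherical r \<theta> \<phi>)" for k
  define h where "h k l = partial_deriv l (partial_deriv k u) (spherical r \<theta> \<phi>)" for k l
  define D1 where "D1 b = (\<Sum>k\<in>UNIV. p k * b k)" for b :: "3 \<Rightarrow> real"
  define D2 where "D2 b c = (\<Sum>k\<in>UNIV. (\<Sum>l\<in>UNIV. h k l * b l) * b k + p k * c k)"
    for b c :: "3 \<Rightarrow> real"
  let ?v = "\<lambda>a b c k. (vector [a, b, c] :: real^3) $ (k::3)"
  have ident: "jet2 (\<lambda>x. x) x 1 0" for x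
    by (rule jet2I[of UNIV _ _ "\<lambda>x. 1"]) auto
  \<comment> \<open>\<open>D1\<close> and \<open>D2\<close> are the two derivatives along a curve with velocity \<open>b\<close> and acceleration \<open>c\<close>.\<close>
  have r: "jet2 (\<lambda>\<rho>. u (spherical \<rho> \<theta> \<phi>)) r
     (D1 (?v (cos \<theta> * sin \<phi>) (sin \<theta> * sin \<phi>) (cos \<phi>)))
     (D2 (?v (cos \<theta> * sin \<phi>) (sin \<theta> * sin \<phi>) (cos \<phi>)) (?v 0 0 0))"
  proof -
    have "\<forall>k. jet2 (\<lambda>\<rho>. spherical \<rho> \<theta> \<phi> $ k) r
       (?v (cos \<theta> * sin \<phi>) (sin \<theta> * sin \<phi>) (cos \<phi>) k) (?v 0 0 0 k)"
      using jet2_cmult[OF ident, of "cos \<theta> * sin \<phi>" r] jet2_cmult[OF ident, of "sin \<theta> * sin \<phi>" r]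
        jet2_cmult[OF ident, of "cos \<phi>" r]
      by (simp add: forall_3 spherical_nth mult_ac)
    then show ?thesis unfolding D1_def D2_def p_def h_def
      by (intro jet2_along_curve[OF assms]) blast
  qed
  have th: "jet2 (\<lambda>\<theta>. u (spherical r \<theta> \<phi>)) \<theta>
     (D1 (?v (- r * sin \<theta> * sin \<phi>) (r * cos \<theta> * sin \<phi>) 0))
     (D2 (?v (- r * sin \<theta> * sin \<phi>) (r * cos \<theta> * sin \<phi>) 0)
         (?v (- r * cos \<theta> * sin \<phi>) (- r * sin \<theta> * sin \<phi>) 0))"
  proof -
    have "\<forall>k. jet2 (\<lambda>\<theta>. spherical r \<theta> \<phi> $ k) \<theta>
       (?v (- r * sin \<theta> * sin \<phi>) (r * cos \<theta> * sin \<phi>) 0 k)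
       (?v (- r * cos \<theta> * sin \<phi>) (- r * sin \<theta> * sin \<phi>) 0 k)"
      using jet2_cmult[OF jet2_cos, of "r * sin \<phi>" \<theta>] jet2_cmult[OF jet2_sin, of "r * sin \<phi>" \<theta>]
        jet2_const[of "r * cos \<phi>" \<theta>]
      by (simp add: forall_3 spherical_nth mult_ac)
    then show ?thesis unfolding D1_def D2_def p_def h_def
      by (intro jet2_along_curve[OF assms]) blast
  qed
  have ph: "jet2 (\<lambda>\<phi>. u (spherical r \<theta> \<phi>)) \<phi>
     (D1 (?v (r * cos \<theta> * cos \<phi>) (r * sin \<theta> * cos \<phi>) (- r * sin \<phi>)))
     (D2 (?v (r * cos \<theta> * cos \<phi>) (r * sin \<theta> * cos \<phi>) (- r * sin \<phi>))
         (?v (- r * cos \<theta> * sin \<phi>) (- r * sin \<theta> * sin \<phi>) (- r * cos \<phi>)))"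
  proof -
    have "\<forall>k. jet2 (\<lambda>\<phi>. spherical r \<theta> \<phi> $ k) \<phi>
       (?v (r * cos \<theta> * cos \<phi>) (r * sin \<theta> * cos \<phi>) (- r * sin \<phi>) k)
       (?v (- r * cos \<theta> * sin \<phi>) (- r * sin \<theta> * sin \<phi>) (- r * cos \<phi>) k)"
      using jet2_cmult[OF jet2_sin, of "r * cos \<theta>" \<phi>] jet2_cmult[OF jet2_sin, of "r * sin \<theta>" \<phi>]
        jet2_cmult[OF jet2_cos, of "r" \<phi>]
      by (simp add: forall_3 spherical_nth mult_ac)
    then show ?thesis unfolding D1_def D2_def p_def h_def
      by (intro jet2_along_curve[OF assms]) blast
  qed
  have t: "(cos \<theta>)\<^sup>2 + (sin \<theta>)\<^sup>2 = 1" and f: "(cos \<phi>)\<^sup>2 + (sin \<phi>)\<^sup>2 = 1" by simp_all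
  have lap: "laplacian u (spherical r \<theta> \<phi>) = h 1 1 + h 2 2 + h 3 3"
    by (simp add: laplacian_def h_def sum_3)
  have eq: "r\<^sup>2 * (sin \<phi>)\<^sup>2 * laplacian u (spherical r \<theta> \<phi>) =
      (sin \<phi>)\<^sup>2 * (r\<^sup>2 * D2 (?v (cos \<theta> * sin \<phi>) (sin \<theta> * sin \<phi>) (cos \<phi>)) (?v 0 0 0)
        + 2 * r * D1 (?v (cos \<theta> * sin \<phi>) (sin \<theta> * sin \<phi>) (cos \<phi>))
        + D2 (?v (r * cos \<theta> * cos \<phi>) (r * sin \<theta> * cos \<phi>) (- r * sin \<phi>))
             (?v (- r * cos \<theta> * sin \<phi>) (- r * sin \<theta> * sin \<phi>) (- r * cos \<phi>)))
      + sin \<phi> * cos \<phi> * D1 (?v (r * cos \<theta> * cos \<phi>) (r * sin \<theta> * cos \<phi>) (- r * sin \<phi>))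
      + D2 (?v (- r * sin \<theta> * sin \<phi>) (r * cos \<theta> * sin \<phi>) 0)
           (?v (- r * cos \<theta> * sin \<phi>) (- r * sin \<theta> * sin \<phi>) 0)"
    unfolding D1_def D2_def sum_3 vector_3 lap using t f by algebra
  show ?thesis unfolding polar_laplace_def
    by (rule exI, rule exI, rule exI, rule exI, rule exI, rule exI,
        rule conjI[OF r], rule conjI[OF th], rule conjI[OF ph], rule eq)
qed

lemma polar_laplace_cmult:
  assumes "polar_laplace u r \<theta> \<phi> L"
  shows "polar_laplace (\<lambda>x. k * u x) r \<theta> \<phi> (k * L)"
proof -
  obtain a1 a2 b1 b2 c1 c2 where
    "jet2 (\<lambda>\<rho>. u (spherical \<rho> \<theta> \<phi>)) r a1 a2"
    "jet2 (\<lambda>\<theta>. u (spherical r \<theta> \<phi>)) \<theta> b1 b2"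
    "jet2 (\<lambda>\<phi>. u (spherical r \<theta> \<phi>)) \<phi> c1 c2" and
    eq: "r\<^sup>2 * (sin \<phi>)\<^sup>2 * L =
      (sin \<phi>)\<^sup>2 * (r\<^sup>2 * a2 + 2 * r * a1 + c2) + sin \<phi> * cos \<phi> * c1 + b2"
    using assms unfolding polar_laplace_def by blast
  note j = this(1-3)[THEN jet2_cmult[where k = k]]
  have e: "r\<^sup>2 * (sin \<phi>)\<^sup>2 * (k * L) =
      (sin \<phi>)\<^sup>2 * (r\<^sup>2 * (k * a2) + 2 * r * (k * a1) + k * c2) + sin \<phi> * cos \<phi> * (k * c1) + k * b2"
    using eq by algebra
  show ?thesis
    unfolding polar_laplace_def using j e by blast
qed

lemma polar_laplace_add:
  assumes "polar_laplace u r \<theta> \<phi> L" "polar_laplace v r \<theta> \<phi> M"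
  shows "polar_laplace (\<lambda>x. u x + v x) r \<theta> \<phi> (L + M)"
proof -
  obtain a1 a2 b1 b2 c1 c2 where
    u: "jet2 (\<lambda>\<rho>. u (spherical \<rho> \<theta> \<phi>)) r a1 a2"
    "jet2 (\<lambda>\<theta>. u (spherical r \<theta> \<phi>)) \<theta> b1 b2"
    "jet2 (\<lambda>\<phi>. u (spherical r \<theta> \<phi>)) \<phi> c1 c2"
    "r\<^sup>2 * (sin \<phi>)\<^sup>2 * L =
      (sin \<phi>)\<^sup>2 * (r\<^sup>2 * a2 + 2 * r * a1 + c2) + sin \<phi> * cos \<phi> * c1 + b2"
    using assms(1) unfolding polar_laplace_def by blast
  obtain d1 d2 e1 e2 k1 k2 where
    v: "jet2 (\<lambda>\<rho>. v (spherical \<rho> \<theta> \<phi>)) r d1 d2"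
    "jet2 (\<lambda>\<theta>. v (spherical r \<theta> \<phi>)) \<theta> e1 e2"
    "jet2 (\<lambda>\<phi>. v (spherical r \<theta> \<phi>)) \<phi> k1 k2"
    "r\<^sup>2 * (sin \<phi>)\<^sup>2 * M =
      (sin \<phi>)\<^sup>2 * (r\<^sup>2 * d2 + 2 * r * d1 + k2) + sin \<phi> * cos \<phi> * k1 + e2"
    using assms(2) unfolding polar_laplace_def by blast
  have e: "r\<^sup>2 * (sin \<phi>)\<^sup>2 * (L + M) =
      (sin \<phi>)\<^sup>2 * (r\<^sup>2 * (a2 + d2) + 2 * r * (a1 + d1) + (c2 + k2))
        + sin \<phi> * cos \<phi> * (c1 + k1) + (b2 + e2)"
    using u(4) v(4) by algebra
  show ?thesis
    unfolding polar_laplace_def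
    using jet2_add[OF u(1) v(1)] jet2_add[OF u(2) v(2)] jet2_add[OF u(3) v(3)] e by blast
qed

lemma polar_laplace_zero: "polar_laplace (\<lambda>x. 0) r \<theta> \<phi> 0"
  unfolding polar_laplace_def by (intro exI[of _ 0] conjI jet2_const) simp

lemma polar_laplace_sum:
  assumes "finite I" "\<And>i. i \<in> I \<Longrightarrow> polar_laplace (u i) r \<theta> \<phi> (L i)"
  shows "polar_laplace (\<lambda>x. \<Sum>i\<in>I. u i x) r \<theta> \<phi> (\<Sum>i\<in>I. L i)"
  using assms
  by (induction I) (auto intro: polar_laplace_add polar_laplace_zero)

lemma polar_laplaceD:
  assumes "polar_laplace u r \<theta> \<phi> L"
    and "jet2 (\<lambda>\<rho>. u (spherical \<rho> \<theta> \<phi>)) r a1 a2"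
    and "jet2 (\<lambda>\<theta>. u (spherical r \<theta> \<phi>)) \<theta> b1 b2"
    and "jet2 (\<lambda>\<phi>. u (spherical r \<theta> \<phi>)) \<phi> c1 c2"
  shows "r\<^sup>2 * (sin \<phi>)\<^sup>2 * L =
      (sin \<phi>)\<^sup>2 * (r\<^sup>2 * a2 + 2 * r * a1 + c2) + sin \<phi> * cos \<phi> * c1 + b2"
  using assms jet2_unique unfolding polar_laplace_def by (smt (verit))

section \<open>Uniaxial tensors and the director frame\<close>

lemma inner_matrix_vector:
  fixes A :: "real^3^3"
  shows "a \<bullet> (A *v b) = (\<Sum>i\<in>UNIV. \<Sum>j\<in>UNIV. (a $ i * b $ j) * A $ i $ j)"
  by (simp add: inner_vec_def matrix_vector_mult_def sum_distrib_left mult_ac)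

lemma inner_uniaxial:
  "a \<bullet> (uniaxial \<sigma> n *v b) = \<sigma> * ((a \<bullet> n) * (b \<bullet> n) - (a \<bullet> b) / 3)"
  unfolding inner_matrix_vector
  by (simp add: uniaxial_def tensor_def mat_def inner_vec_def sum_3 algebra_simps)

lemma uniaxial_nth:
  "uniaxial \<sigma> n $ i $ j = \<sigma> * (n $ i * n $ j - (if i = j then 1 / 3 else 0))"
  by (simp add: uniaxial_def tensor_def mat_def)

lemma norm_eq_1_vec3: "norm (n :: real^3) = 1 \<longleftrightarrow> n $ 1 * n $ 1 + n $ 2 * n $ 2 + n $ 3 * n $ 3 = 1"
  by (simp add: norm_eq_1 inner_vec_def sum_3)

lemma uniaxial_square_nth:
  assumes "norm n = 1"
  shows "(uniaxial \<sigma> n ** uniaxial \<sigma> n) $ i $ j = \<sigma>\<^sup>2 / 3 * (n $ i * n $ j + (if i = j then 1 / 3 else 0))"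
proof -
  have n: "n $ 1 * n $ 1 + n $ 2 * n $ 2 + n $ 3 * n $ 3 = 1" using assms norm_eq_1_vec3 by blast
  have "\<forall>i j. (uniaxial \<sigma> n ** uniaxial \<sigma> n) $ i $ j = \<sigma>\<^sup>2 / 3 * (n $ i * n $ j + (if i = j then 1 / 3 else 0))"
    unfolding matrix_matrix_mult_def forall_3 by (simp add: sum_3 uniaxial_nth) (use n in algebra)
  then show ?thesis by blast
qed

lemma trace_uniaxial_square:
  assumes "norm n = 1"
  shows "trace (uniaxial \<sigma> n ** uniaxial \<sigma> n) = 2 / 3 * \<sigma>\<^sup>2"
proof -
  have n: "n $ 1 * n $ 1 + n $ 2 * n $ 2 + n $ 3 * n $ 3 = 1" using assms norm_eq_1_vec3 by blast
  show ?thesis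
    by (simp add: trace_def sum_3 uniaxial_square_nth[OF assms]) (use n in algebra)
qed

lemma trace_uniaxial_cube:
  assumes "norm n = 1"
  shows "trace (uniaxial \<sigma> n ** uniaxial \<sigma> n ** uniaxial \<sigma> n) = 2 / 9 * \<sigma>^3"
proof -
  have n: "n $ 1 * n $ 1 + n $ 2 * n $ 2 + n $ 3 * n $ 3 = 1" using assms norm_eq_1_vec3 by blast
  show ?thesis
    unfolding trace_def matrix_matrix_mult_def[of "uniaxial \<sigma> n ** uniaxial \<sigma> n"]
    by (simp add: sum_3 uniaxial_square_nth[OF assms] uniaxial_nth) (use n in algebra)
qed

text \<open>For a uniaxial tensor \<open>tr A\<^sup>2 = 2 \<sigma>\<^sup>2 / 3\<close> and \<open>tr A\<^sup>3 = 2 \<sigma>\<^sup>3 / 9\<close>. The quotient recovers \<open>\<sigma>\<close> with its sign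
as a rational function of the entries, so it inherits their regularity wherever \<open>\<sigma> \<noteq> 0\<close>; at \<open>\<sigma> = 0\<close> the
convention \<open>x / 0 = 0\<close> gives the right value.\<close>

definition scalar_order :: "real^3^3 \<Rightarrow> real" where
  "scalar_order A = 3 * trace (A ** A ** A) / trace (A ** A)"

lemma scalar_order_uniaxial: "norm n = 1 \<Longrightarrow> scalar_order (uniaxial \<sigma> n) = \<sigma>"
  by (simp add: scalar_order_def trace_uniaxial_square trace_uniaxial_cube power2_eq_square power3_eq_cube)

lemma uniaxial_eq_0_iff: "norm n = 1 \<Longrightarrow> uniaxial \<sigma> n = 0 \<longleftrightarrow> \<sigma> = 0"
proof
  assume n: "norm n = 1" and "uniaxial \<sigma> n = 0"
  then have "scalar_order (0 :: real^3^3) = \<sigma>" using scalar_order_uniaxial by metis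
  then show "\<sigma> = 0" by (simp add: scalar_order_def trace_def)
qed (simp add: uniaxial_def)

definition bulk :: "real \<Rightarrow> real \<Rightarrow> real" where
  "bulk t \<sigma> = t * \<sigma> - sqrt 6 * \<sigma>\<^sup>2 + 4 / 3 * \<sigma>^3"

text \<open>Since \<open>Q\<^sup>2 - tr (Q\<^sup>2) I / 3 = (\<sigma>\<^sup>2 / 3) (n \<otimes> n - I/3)\<close>, every term on the right-hand side of the system
is a multiple of \<open>n \<otimes> n - I/3\<close>, and the right-hand side is again uniaxial with director \<open>n\<close>.\<close>

lemma EL_solution_laplacian:
  assumes "EL_solution t Q" "Q x = uniaxial \<sigma> n" "norm n = 1"
  shows "laplacian (\<lambda>y. Q y $ i $ j) x = uniaxial (bulk t \<sigma>) n $ i $ j"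
proof -
  have "laplacian (\<lambda>y. Q y $ i $ j) x = t * Q x $ i $ j
        - 3 * sqrt 6 * ((Q x ** Q x) $ i $ j - 1/3 * mat 1 $ i $ j * trace (Q x ** Q x))
        + 2 * Q x $ i $ j * trace (Q x ** Q x)"
    using assms(1) unfolding EL_solution_def by blast
  then show ?thesis
    unfolding assms(2) trace_uniaxial_square[OF assms(3)] uniaxial_square_nth[OF assms(3)] uniaxial_nth
    by (cases "i = j") (simp_all add: bulk_def mat_def power2_eq_square power3_eq_cube algebra_simps diff_divide_distrib)
qed

definition direction :: "real \<Rightarrow> real \<Rightarrow> real^3" where
  "direction \<alpha> \<beta> = vector [sin \<alpha> * cos \<beta>, sin \<alpha> * sin \<beta>, cos \<alpha>]"

text \<open>The unit vectors \<open>polar_dir \<alpha> \<beta>\<close> and \<open>azimuth_dir \<beta>\<close> are the directions of the \<open>\<alpha>\<close>- and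
\<open>\<beta>\<close>-derivatives of \<open>direction \<alpha> \<beta>\<close>; the three vectors form an orthonormal frame.\<close>

definition polar_dir :: "real \<Rightarrow> real \<Rightarrow> real^3" where
  "polar_dir \<alpha> \<beta> = vector [cos \<alpha> * cos \<beta>, cos \<alpha> * sin \<beta>, - sin \<alpha>]"

definition azimuth_dir :: "real \<Rightarrow> real^3" where
  "azimuth_dir \<beta> = vector [- sin \<beta>, cos \<beta>, 0]"

text \<open>A moving director tested against the frame of a fixed one depends only on the two polar angles and on
\<open>\<beta>' - \<beta>\<close>, which keeps the derivatives in \<open>frame_equations\<close> short.\<close>

lemma inner_direction:
  "direction \<alpha> \<beta> \<bullet> direction \<alpha>' \<beta>' = sin \<alpha> * sin \<alpha>' * cos (\<beta>' - \<beta>) + cos \<alpha> * cos \<alpha>'"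
  "polar_dir \<alpha> \<beta> \<bullet> direction \<alpha>' \<beta>' = cos \<alpha> * sin \<alpha>' * cos (\<beta>' - \<beta>) - sin \<alpha> * cos \<alpha>'"
  "azimuth_dir \<beta> \<bullet> direction \<alpha>' \<beta>' = sin \<alpha>' * sin (\<beta>' - \<beta>)"
  by (simp_all add: direction_def polar_dir_def azimuth_dir_def inner_vec_def sum_3 cos_diff sin_diff algebra_simps)

lemma frame_orthonormal:
  "polar_dir \<alpha> \<beta> \<bullet> polar_dir \<alpha> \<beta> = 1"
  "azimuth_dir \<beta> \<bullet> azimuth_dir \<beta> = 1"
  "direction \<alpha> \<beta> \<bullet> polar_dir \<alpha> \<beta> = 0"
  "direction \<alpha> \<beta> \<bullet> azimuth_dir \<beta> = 0"
proof -
  have *: "(cos \<alpha>)\<^sup>2 + (sin \<alpha>)\<^sup>2 = 1" "(cos \<beta>)\<^sup>2 + (sin \<beta>)\<^sup>2 = 1" by simp_all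
  show "polar_dir \<alpha> \<beta> \<bullet> polar_dir \<alpha> \<beta> = 1"
    "azimuth_dir \<beta> \<bullet> azimuth_dir \<beta> = 1"
    "direction \<alpha> \<beta> \<bullet> polar_dir \<alpha> \<beta> = 0"
    "direction \<alpha> \<beta> \<bullet> azimuth_dir \<beta> = 0"
    unfolding direction_def polar_dir_def azimuth_dir_def inner_vec_def sum_3 vector_3 inner_real_def
    using * by (algebra, algebra, algebra, simp)
qed

lemma norm_direction: "norm (direction \<alpha> \<beta>) = 1"
  by (simp add: norm_eq_1 inner_direction flip: power2_eq_square)

lemma twice_order:
  fixes A :: "real \<Rightarrow> real^3^3"
  assumes "\<And>i j. twice (\<lambda>y. A y $ i $ j) x" "trace (A x ** A x) \<noteq> 0"
  shows "twice (\<lambda>y. scalar_order (A y)) x"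
proof -
  have "twice (\<lambda>y. trace (A y ** A y)) x"
    unfolding trace_def matrix_matrix_mult_def
    by (simp, intro twice_sum twice_mult assms(1)) auto
  moreover have "twice (\<lambda>y. trace (A y ** A y ** A y)) x"
    unfolding trace_def matrix_matrix_mult_def
    by (simp, intro twice_sum twice_mult assms(1)) auto
  ultimately show ?thesis
    unfolding scalar_order_def using assms(2) by (intro twice_divide twice_mult twice_const)
qed

section \<open>The Euler-Lagrange system in the director frame\<close>

locale separated_uniaxial =
  fixes t :: real and Q :: "real^3 \<Rightarrow> real^3^3" and s :: "real \<Rightarrow> real \<Rightarrow> real \<Rightarrow> real" and f g :: "real \<Rightarrow> real"
  assumes EL: "EL_solution t Q"
    and Q_spherical: "\<And>r \<theta> \<phi>. 0 \<le> r \<Longrightarrow> \<theta> \<in> {0..<2 * pi} \<Longrightarrow> \<phi> \<in> {0..pi} \<Longrightarrow>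
           Q (spherical r \<theta> \<phi>) = uniaxial (s r \<theta> \<phi>) (direction (f \<phi>) (g \<theta>))"
    and cont_f: "continuous_on {0..pi} f"
    and cont_g: "continuous_on {0..<2 * pi} g"
begin

lemma Q_C2: "C2 (\<lambda>x. Q x $ i $ j)"
  using EL unfolding EL_solution_def by blast

text \<open>The system tested with a fixed pair \<open>(a, b)\<close>. The scalar \<open>a \<bullet> Q b\<close> is the product of \<open>s\<close> and a function
\<open>K\<close> of the two angles alone, so all its derivatives come from the product rule in one variable.\<close>

lemma contracted_equation:
  fixes a b :: "real^3"
  defines "K \<equiv> \<lambda>\<theta> \<phi>. (a \<bullet> direction (f \<phi>) (g \<theta>)) * (b \<bullet> direction (f \<phi>) (g \<theta>)) - (a \<bullet> b) / 3"
  assumes "0 < r" "\<theta> \<in> {0<..<2 * pi}" "\<phi> \<in> {0<..<pi}"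
    and sr: "jet2 (\<lambda>\<rho>. s \<rho> \<theta> \<phi>) r sr srr"
    and st: "jet2 (\<lambda>\<theta>. s r \<theta> \<phi>) \<theta> st stt"
    and sp: "jet2 (\<lambda>\<phi>. s r \<theta> \<phi>) \<phi> sp spp"
    and Kt: "jet2 (\<lambda>\<theta>. K \<theta> \<phi>) \<theta> kt ktt"
    and Kp: "jet2 (\<lambda>\<phi>. K \<theta> \<phi>) \<phi> kp kpp"
  shows "r\<^sup>2 * (sin \<phi>)\<^sup>2 * (bulk t (s r \<theta> \<phi>) * K \<theta> \<phi>) =
     (sin \<phi>)\<^sup>2 * (r\<^sup>2 * (srr * K \<theta> \<phi>) + 2 * r * (sr * K \<theta> \<phi>)
       + (spp * K \<theta> \<phi> + 2 * sp * kp + s r \<theta> \<phi> * kpp))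
     + sin \<phi> * cos \<phi> * (sp * K \<theta> \<phi> + s r \<theta> \<phi> * kp)
     + (stt * K \<theta> \<phi> + 2 * st * kt + s r \<theta> \<phi> * ktt)"
proof -
  define q where "q x = a \<bullet> (Q x *v b)" for x
  have q: "q (spherical \<rho> \<theta>' \<phi>') = s \<rho> \<theta>' \<phi>' * K \<theta>' \<phi>'"
    if "0 < \<rho>" "\<theta>' \<in> {0<..<2 * pi}" "\<phi>' \<in> {0<..<pi}" for \<rho> \<theta>' \<phi>'
    using that by (simp add: q_def Q_spherical inner_uniaxial K_def)
  have er: "\<forall>\<^sub>F \<rho> in nhds r. \<rho> \<in> {0<..}" using assms by (intro eventually_nhds_in_open) auto
  have et: "\<forall>\<^sub>F \<theta>' in nhds \<theta>. \<theta>' \<in> {0<..<2 * pi}" using assms by (intro eventually_nhds_in_open) auto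
  have ep: "\<forall>\<^sub>F \<phi>' in nhds \<phi>. \<phi>' \<in> {0<..<pi}" using assms by (intro eventually_nhds_in_open) auto
  let ?n = "direction (f \<phi>) (g \<theta>)"
  have "laplacian (\<lambda>y. Q y $ i $ j) (spherical r \<theta> \<phi>) = uniaxial (bulk t (s r \<theta> \<phi>)) ?n $ i $ j" for i j
    using assms by (intro EL_solution_laplacian[OF EL] Q_spherical) (auto simp: norm_direction)
  then have "polar_laplace (\<lambda>x. Q x $ i $ j) r \<theta> \<phi> (uniaxial (bulk t (s r \<theta> \<phi>)) ?n $ i $ j)" for i j
    using polar_laplace_C2[OF Q_C2] by metis
  then have "polar_laplace q r \<theta> \<phi> (a \<bullet> (uniaxial (bulk t (s r \<theta> \<phi>)) ?n *v b))"
    unfolding q_def inner_matrix_vector by (intro polar_laplace_sum polar_laplace_cmult) auto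
  then have L: "polar_laplace q r \<theta> \<phi> (bulk t (s r \<theta> \<phi>) * K \<theta> \<phi>)"
    unfolding inner_uniaxial K_def .
  have 1: "jet2 (\<lambda>\<rho>. q (spherical \<rho> \<theta> \<phi>)) r (sr * K \<theta> \<phi>) (srr * K \<theta> \<phi>)"
    by (rule jet2_cong[OF jet2_mult[OF sr jet2_const[of "K \<theta> \<phi>"], simplified]])
      (use er in \<open>eventually_elim\<close>, use assms q in auto)
  have 2: "jet2 (\<lambda>\<theta>. q (spherical r \<theta> \<phi>)) \<theta> (st * K \<theta> \<phi> + s r \<theta> \<phi> * kt)
      (stt * K \<theta> \<phi> + 2 * st * kt + s r \<theta> \<phi> * ktt)"
    by (rule jet2_cong[OF jet2_mult[OF st Kt]])
      (use et in \<open>eventually_elim\<close>, use assms q in auto)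
  have 3: "jet2 (\<lambda>\<phi>. q (spherical r \<theta> \<phi>)) \<phi> (sp * K \<theta> \<phi> + s r \<theta> \<phi> * kp)
      (spp * K \<theta> \<phi> + 2 * sp * kp + s r \<theta> \<phi> * kpp)"
    by (rule jet2_cong[OF jet2_mult[OF sp Kp]])
      (use ep in \<open>eventually_elim\<close>, use assms q in auto)
  show ?thesis using polar_laplaceD[OF L 1 2 3] .
qed

text \<open>The pairs \<open>(e, e)\<close>, \<open>(h, h)\<close>, \<open>(n, e)\<close> and \<open>(n, h)\<close> of the director frame at the point, in this order.
The frame is frozen at that point, and the director moves along the coordinate lines. At the point itself
\<open>e \<bullet> n = h \<bullet> n = 0\<close>, so for the first two pairs \<open>K\<close> is stationary with value \<open>- 1 / 3\<close> and its second
derivative is twice the square of the derivative of \<open>e \<bullet> n\<close> or \<open>h \<bullet> n\<close>; for the mixed pairs \<open>K = 0\<close> at the point, so the second-order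
operator on \<open>s\<close> drops out.\<close>

lemma frame_equations:
  assumes dom: "0 < r" "\<theta> \<in> {0<..<2 * pi}" "\<phi> \<in> {0<..<pi}"
    and jets: "jet2 (\<lambda>\<rho>. s \<rho> \<theta> \<phi>) r sr srr"
      "jet2 (\<lambda>\<theta>. s r \<theta> \<phi>) \<theta> st stt"
      "jet2 (\<lambda>\<phi>. s r \<theta> \<phi>) \<phi> sp spp"
    and jf: "jet2 f \<phi> f1 f2" and jg: "jet2 g \<theta> g1 g2"
  defines "L \<equiv> (sin \<phi>)\<^sup>2 * (r\<^sup>2 * srr + 2 * r * sr + spp) + sin \<phi> * cos \<phi> * sp + stt"
  shows "L - r\<^sup>2 * (sin \<phi>)\<^sup>2 * bulk t (s r \<theta> \<phi>) = 6 * s r \<theta> \<phi> * (f1\<^sup>2 * (sin \<phi>)\<^sup>2)"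
    and "L - r\<^sup>2 * (sin \<phi>)\<^sup>2 * bulk t (s r \<theta> \<phi>) = 6 * s r \<theta> \<phi> * (g1\<^sup>2 * (sin (f \<phi>))\<^sup>2)"
    and "s r \<theta> \<phi> * (f2 * (sin \<phi>)\<^sup>2 + f1 * (sin \<phi> * cos \<phi>) - g1\<^sup>2 * (sin (f \<phi>) * cos (f \<phi>)))
           + 2 * sp * f1 * (sin \<phi>)\<^sup>2 = 0"
    and "sin (f \<phi>) * (s r \<theta> \<phi> * g2 + 2 * st * g1) = 0"
proof -
  let ?\<alpha> = "f \<phi>" and ?\<beta> = "g \<theta>"
  have shift: "jet2 (\<lambda>y. y - c) x 1 0" for c x
    by (rule jet2I[of UNIV _ _ "\<lambda>y. 1"]) (auto intro!: derivative_eq_intros)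
  have sub: "jet2 (\<lambda>y. h y - c) x b d" if "jet2 h x b d" for h c x b d
    using jet2_compose[OF that shift[of c]] by simp
  have sf: "jet2 (\<lambda>\<phi>. sin (f \<phi> - ?\<alpha>)) \<phi> f1 f2" and cf: "jet2 (\<lambda>\<phi>. cos (f \<phi> - ?\<alpha>)) \<phi> 0 (- f1\<^sup>2)"
    using jet2_compose[OF sub[OF jf] jet2_sin, of ?\<alpha>] jet2_compose[OF sub[OF jf] jet2_cos, of ?\<alpha>]
    by simp_all
  have sg: "jet2 (\<lambda>\<theta>. sin (g \<theta> - ?\<beta>)) \<theta> g1 g2" and cg: "jet2 (\<lambda>\<theta>. cos (g \<theta> - ?\<beta>)) \<theta> 0 (- g1\<^sup>2)"
    using jet2_compose[OF sub[OF jg] jet2_sin, of ?\<beta>] jet2_compose[OF sub[OF jg] jet2_cos, of ?\<beta>]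
    by simp_all
  have add: "jet2 (\<lambda>y. h y + c) x b d" if "jet2 h x b d" for h c x b d
    using jet2_add[OF that jet2_const[of c]] by simp
  let ?n = "\<lambda>\<theta> \<phi>. direction (f \<phi>) (g \<theta>)"
  let ?nn = "direction ?\<alpha> ?\<beta>" and ?e = "polar_dir ?\<alpha> ?\<beta>" and ?h = "azimuth_dir ?\<beta>"
  have np: "jet2 (\<lambda>\<phi>. ?nn \<bullet> ?n \<theta> \<phi>) \<phi> 0 (- f1\<^sup>2)" and ep: "jet2 (\<lambda>\<phi>. ?e \<bullet> ?n \<theta> \<phi>) \<phi> f1 f2"
    and hp: "jet2 (\<lambda>\<phi>. ?h \<bullet> ?n \<theta> \<phi>) \<phi> 0 0"
    using cf sf jet2_const[of 0] by (simp_all add: inner_direction cos_diff sin_diff mult.commute add.commute)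
  have nt: "jet2 (\<lambda>\<theta>. ?nn \<bullet> ?n \<theta> \<phi>) \<theta> 0 (- (sin ?\<alpha>)\<^sup>2 * g1\<^sup>2)"
    using add[OF jet2_cmult[OF cg, of "(sin ?\<alpha>)\<^sup>2"], of "(cos ?\<alpha>)\<^sup>2"]
    by (simp add: inner_direction power2_eq_square)
  have et: "jet2 (\<lambda>\<theta>. ?e \<bullet> ?n \<theta> \<phi>) \<theta> 0 (- (sin ?\<alpha> * cos ?\<alpha>) * g1\<^sup>2)"
    using add[OF jet2_cmult[OF cg, of "sin ?\<alpha> * cos ?\<alpha>"], of "- sin ?\<alpha> * cos ?\<alpha>"]
    by (simp add: inner_direction mult.commute)
  have ht: "jet2 (\<lambda>\<theta>. ?h \<bullet> ?n \<theta> \<phi>) \<theta> (sin ?\<alpha> * g1) (sin ?\<alpha> * g2)"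
    using jet2_cmult[OF sg, of "sin ?\<alpha>"] by (simp add: inner_direction)
  have K: "jet2 (\<lambda>y. u y * v y - c) x (b * v x + u x * b') (d * v x + 2 * b * b' + u x * d')"
    if "jet2 u x b d" "jet2 v x b' d'" for u v c x b b' d d'
    using sub[OF jet2_mult[OF that]] .
  have at: "?nn \<bullet> ?n \<theta> \<phi> = 1" "?e \<bullet> ?n \<theta> \<phi> = 0" "?h \<bullet> ?n \<theta> \<phi> = 0"
    by (simp_all add: inner_direction mult.commute flip: power2_eq_square)
  note eqs = contracted_equation[OF dom jets K K]
  have "r\<^sup>2 * (sin \<phi>)\<^sup>2 * (bulk t (s r \<theta> \<phi>) * (- 1 / 3)) =
     (sin \<phi>)\<^sup>2 * (r\<^sup>2 * (srr * (- 1 / 3)) + 2 * r * (sr * (- 1 / 3))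
       + (spp * (- 1 / 3) + s r \<theta> \<phi> * (2 * f1 * f1)))
     + sin \<phi> * cos \<phi> * (sp * (- 1 / 3)) + stt * (- 1 / 3)"
    using eqs[OF et et ep ep] unfolding at frame_orthonormal by simp
  then show "L - r\<^sup>2 * (sin \<phi>)\<^sup>2 * bulk t (s r \<theta> \<phi>) = 6 * s r \<theta> \<phi> * (f1\<^sup>2 * (sin \<phi>)\<^sup>2)"
    unfolding L_def by (simp add: power2_eq_square field_simps)
  have "r\<^sup>2 * (sin \<phi>)\<^sup>2 * (bulk t (s r \<theta> \<phi>) * (- 1 / 3)) =
     (sin \<phi>)\<^sup>2 * (r\<^sup>2 * (srr * (- 1 / 3)) + 2 * r * (sr * (- 1 / 3)) + spp * (- 1 / 3))
     + sin \<phi> * cos \<phi> * (sp * (- 1 / 3)) + (stt * (- 1 / 3) + s r \<theta> \<phi> * (2 * (sin ?\<alpha> * g1) * (sin ?\<alpha> * g1)))"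
    using eqs[OF ht ht hp hp] unfolding at frame_orthonormal by simp
  then show "L - r\<^sup>2 * (sin \<phi>)\<^sup>2 * bulk t (s r \<theta> \<phi>) = 6 * s r \<theta> \<phi> * (g1\<^sup>2 * (sin (f \<phi>))\<^sup>2)"
    unfolding L_def by (simp add: power2_eq_square field_simps)
  show "s r \<theta> \<phi> * (f2 * (sin \<phi>)\<^sup>2 + f1 * (sin \<phi> * cos \<phi>) - g1\<^sup>2 * (sin (f \<phi>) * cos (f \<phi>)))
           + 2 * sp * f1 * (sin \<phi>)\<^sup>2 = 0"
    using eqs[OF nt et np ep] unfolding at frame_orthonormal by (simp add: algebra_simps)
  show "sin (f \<phi>) * (s r \<theta> \<phi> * g2 + 2 * st * g1) = 0"
    using eqs[OF nt ht np hp] unfolding at frame_orthonormal by (simp add: algebra_simps)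
qed

end

section \<open>Regularity where the field does not vanish\<close>

context separated_uniaxial
begin

lemma Q_line_twice:
  "twice (\<lambda>\<rho>. Q (spherical \<rho> \<theta> \<phi>) $ i $ j) r"
  "twice (\<lambda>\<theta>. Q (spherical r \<theta> \<phi>) $ i $ j) \<theta>"
  "twice (\<lambda>\<phi>. Q (spherical r \<theta> \<phi>) $ i $ j) \<phi>"
  using polar_laplace_C2[OF Q_C2[of i j], of r \<theta> \<phi>] unfolding polar_laplace_def twice_def by blast+

lemma s_eq_scalar_order:
  assumes "0 \<le> r" "\<theta> \<in> {0..<2 * pi}" "\<phi> \<in> {0..pi}"
  shows "s r \<theta> \<phi> = scalar_order (Q (spherical r \<theta> \<phi>))"
  using assms by (simp add: Q_spherical scalar_order_uniaxial norm_direction)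

text \<open>Only \<open>Q\<close> is assumed to be twice differentiable; \<open>s\<close>, \<open>f\<close> and \<open>g\<close> inherit this from it. The entries of \<open>Q / s\<close>
contain \<open>cos\<^sup>2 f\<close>, and after a rotation about the third axis by the fixed angle \<open>g \<theta>\<close> also
\<open>sin f cos f\<close>. Where \<open>sin f \<noteq> 0\<close>, the first two rows give \<open>cos\<^sup>2 g\<close> and \<open>sin g cos g\<close> in the same
way.\<close>

lemma regular_where_nonzero:
  assumes dom: "0 < r" "\<theta> \<in> {0<..<2 * pi}" "\<phi> \<in> {0<..<pi}" and nz: "s r \<theta> \<phi> \<noteq> 0"
  shows "twice (\<lambda>\<rho>. s \<rho> \<theta> \<phi>) r" "twice (\<lambda>\<theta>. s r \<theta> \<phi>) \<theta>" "twice (\<lambda>\<phi>. s r \<theta> \<phi>) \<phi>"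
    and "twice f \<phi>" and "sin (f \<phi>) \<noteq> 0 \<Longrightarrow> twice g \<theta>"
proof -
  have er: "\<forall>\<^sub>F \<rho> in nhds r. \<rho> \<in> {0<..}" using dom by (intro eventually_nhds_in_open) auto
  have et: "\<forall>\<^sub>F \<theta>' in nhds \<theta>. \<theta>' \<in> {0<..<2 * pi}" using dom by (intro eventually_nhds_in_open) auto
  have ep: "\<forall>\<^sub>F \<phi>' in nhds \<phi>. \<phi>' \<in> {0<..<pi}" using dom by (intro eventually_nhds_in_open) auto
  have tr: "trace (Q (spherical r \<theta> \<phi>) ** Q (spherical r \<theta> \<phi>)) \<noteq> 0"
    using dom nz by (simp add: Q_spherical trace_uniaxial_square norm_direction)
  show "twice (\<lambda>\<rho>. s \<rho> \<theta> \<phi>) r"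
    by (rule twice_cong[OF twice_order[where A = "\<lambda>\<rho>. Q (spherical \<rho> \<theta> \<phi>)", OF Q_line_twice(1) tr]])
      (use er in \<open>eventually_elim\<close>, use dom s_eq_scalar_order in auto)
  show st: "twice (\<lambda>\<theta>. s r \<theta> \<phi>) \<theta>"
    by (rule twice_cong[OF twice_order[where A = "\<lambda>\<theta>. Q (spherical r \<theta> \<phi>)", OF Q_line_twice(2) tr]])
      (use et in \<open>eventually_elim\<close>, use dom s_eq_scalar_order in auto)
  show sp: "twice (\<lambda>\<phi>. s r \<theta> \<phi>) \<phi>"
    by (rule twice_cong[OF twice_order[where A = "\<lambda>\<phi>. Q (spherical r \<theta> \<phi>)", OF Q_line_twice(3) tr]])
      (use ep in \<open>eventually_elim\<close>, use dom s_eq_scalar_order in auto)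
  let ?q = "\<lambda>\<theta> \<phi> i j. Q (spherical r \<theta> \<phi>) $ i $ j"
  have entries:
    "(cos (f \<phi>'))\<^sup>2 = ?q \<theta>' \<phi>' 3 3 / s r \<theta>' \<phi>' + 1 / 3"
    "sin (f \<phi>') * cos (f \<phi>') = (cos (g \<theta>') * ?q \<theta>' \<phi>' 1 3 + sin (g \<theta>') * ?q \<theta>' \<phi>' 2 3) / s r \<theta>' \<phi>'"
    "(sin (f \<phi>'))\<^sup>2 * (cos (g \<theta>'))\<^sup>2 = ?q \<theta>' \<phi>' 1 1 / s r \<theta>' \<phi>' + 1 / 3"
    "(sin (f \<phi>'))\<^sup>2 * (sin (g \<theta>') * cos (g \<theta>')) = ?q \<theta>' \<phi>' 1 2 / s r \<theta>' \<phi>'"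
    if "\<theta>' \<in> {0<..<2 * pi}" "\<phi>' \<in> {0<..<pi}" "s r \<theta>' \<phi>' \<noteq> 0" for \<theta>' \<phi>'
  proof -
    have Q: "Q (spherical r \<theta>' \<phi>') = uniaxial (s r \<theta>' \<phi>') (direction (f \<phi>') (g \<theta>'))"
      using that dom by (intro Q_spherical) auto
    have *: "(cos (g \<theta>'))\<^sup>2 + (sin (g \<theta>'))\<^sup>2 = 1" by simp
    show "(cos (f \<phi>'))\<^sup>2 = ?q \<theta>' \<phi>' 3 3 / s r \<theta>' \<phi>' + 1 / 3"
      "(sin (f \<phi>'))\<^sup>2 * (cos (g \<theta>'))\<^sup>2 = ?q \<theta>' \<phi>' 1 1 / s r \<theta>' \<phi>' + 1 / 3"
      "(sin (f \<phi>'))\<^sup>2 * (sin (g \<theta>') * cos (g \<theta>')) = ?q \<theta>' \<phi>' 1 2 / s r \<theta>' \<phi>'"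
      using that by (simp_all add: Q uniaxial_nth direction_def power2_eq_square mult_ac)
    have "(cos (g \<theta>') * ?q \<theta>' \<phi>' 1 3 + sin (g \<theta>') * ?q \<theta>' \<phi>' 2 3) =
      s r \<theta>' \<phi>' * (sin (f \<phi>') * cos (f \<phi>'))"
      unfolding Q uniaxial_nth direction_def vector_3 by simp (use * in algebra)
    then show "sin (f \<phi>') * cos (f \<phi>') = (cos (g \<theta>') * ?q \<theta>' \<phi>' 1 3 + sin (g \<theta>') * ?q \<theta>' \<phi>' 2 3) / s r \<theta>' \<phi>'"
      using that by simp
  qed
  have nt: "\<forall>\<^sub>F \<theta>' in nhds \<theta>. s r \<theta>' \<phi> \<noteq> 0" using twice_eventually_nonzero[OF st] nz by simp
  have np: "\<forall>\<^sub>F \<phi>' in nhds \<phi>. s r \<theta> \<phi>' \<noteq> 0" using twice_eventually_nonzero[OF sp] nz by simp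
  show "twice f \<phi>"
  proof (rule twice_half_angle)
    have "twice (\<lambda>\<phi>. ?q \<theta> \<phi> 3 3 / s r \<theta> \<phi> + 1 / 3) \<phi>"
      by (intro twice_add twice_divide twice_const Q_line_twice sp nz)
    then show "twice (\<lambda>\<phi>. (cos (f \<phi>))\<^sup>2) \<phi>"
      by (rule twice_cong) (use ep np in eventually_elim, use entries(1) dom in blast)
    have "twice (\<lambda>\<phi>. (cos (g \<theta>) * ?q \<theta> \<phi> 1 3 + sin (g \<theta>) * ?q \<theta> \<phi> 2 3) / s r \<theta> \<phi>) \<phi>"
      by (intro twice_add twice_mult twice_divide twice_const Q_line_twice sp nz)
    then show "twice (\<lambda>\<phi>. sin (f \<phi>) * cos (f \<phi>)) \<phi>"
      by (rule twice_cong) (use ep np in eventually_elim, use entries(2) dom in blast)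
    show "continuous_on {0<..<pi} f" using cont_f by (rule continuous_on_subset) auto
  qed (use dom in auto)
  show "twice g \<theta>" if sf: "sin (f \<phi>) \<noteq> 0"
  proof (rule twice_half_angle)
    have "twice (\<lambda>\<theta>. (?q \<theta> \<phi> 1 1 / s r \<theta> \<phi> + 1 / 3) / (sin (f \<phi>))\<^sup>2) \<theta>"
      by (intro twice_add twice_divide twice_const Q_line_twice st nz) (use sf in simp)
    then show "twice (\<lambda>\<theta>. (cos (g \<theta>))\<^sup>2) \<theta>"
      by (rule twice_cong)
         (use et nt in eventually_elim, use entries(3)[of _ \<phi>] dom sf in \<open>simp add: field_simps\<close>)
    have "twice (\<lambda>\<theta>. ?q \<theta> \<phi> 1 2 / s r \<theta> \<phi> / (sin (f \<phi>))\<^sup>2) \<theta>"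
      by (intro twice_divide twice_const Q_line_twice st nz) (use sf in simp)
    then show "twice (\<lambda>\<theta>. sin (g \<theta>) * cos (g \<theta>)) \<theta>"
      by (rule twice_cong)
         (use et nt in eventually_elim, use entries(4)[of _ \<phi>] dom sf in \<open>simp add: field_simps\<close>)
    show "continuous_on {0<..<2 * pi} g" using cont_g by (rule continuous_on_subset) auto
  qed (use dom in auto)
qed

end

section \<open>Rigidity on a coordinate box\<close>

context separated_uniaxial
begin

text \<open>Separation of variables in \<open>f'\<^sup>2 sin\<^sup>2 \<phi> = g'\<^sup>2 sin\<^sup>2 f\<close>: either both sides vanish identically, or the
director is the hedgehog up to a shift and a reflection of the angles. In the second case the conformal maps
with \<open>g'\<^sup>2 = C \<noteq> 1\<close> are excluded because \<open>s\<close> is radial, which forces \<open>f'\<close> to be constant. The box has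
positive thickness in \<open>r\<close> because the \<open>r\<close>-derivatives of \<open>s\<close> enter this last step.\<close>

lemma box_dichotomy:
  fixes r\<^sub>1 r\<^sub>2 a b c d :: real
  defines "R \<equiv> {r\<^sub>1<..<r\<^sub>2}" and "I \<equiv> {a<..<b}" and "J \<equiv> {c<..<d}"
  assumes dom: "0 \<le> r\<^sub>1" "r\<^sub>1 < r\<^sub>2" "a < b" "c < d" "I \<subseteq> {0<..<2 * pi}" "J \<subseteq> {0<..<pi}"
    and nonzero: "\<forall>r\<in>R. \<forall>\<theta>\<in>I. \<forall>\<phi>\<in>J. s r \<theta> \<phi> \<noteq> 0" "\<forall>\<phi>\<in>J. sin (f \<phi>) \<noteq> 0"
  shows "(\<forall>\<theta>\<in>I. \<forall>\<theta>'\<in>I. g \<theta> = g \<theta>') \<and> (\<forall>\<phi>\<in>J. \<forall>\<phi>'\<in>J. f \<phi> = f \<phi>') \<or>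
    (\<exists>\<kappa> \<gamma>. \<kappa>\<^sup>2 = 1 \<and> \<gamma>\<^sup>2 = 1 \<and>
       (\<forall>\<phi>\<in>J. jet2 f \<phi> \<kappa> 0 \<and> (sin (f \<phi>))\<^sup>2 = (sin \<phi>)\<^sup>2) \<and> (\<forall>\<theta>\<in>I. jet2 g \<theta> \<gamma> 0) \<and>
       (\<forall>r\<in>R. \<forall>\<theta>\<in>I. \<forall>\<phi>\<in>J. \<forall>\<theta>'\<in>I. \<forall>\<phi>'\<in>J. s r \<theta> \<phi> = s r \<theta>' \<phi>'))"
proof -
  have nz: "s r \<theta> \<phi> \<noteq> 0" if "r \<in> R" "\<theta> \<in> I" "\<phi> \<in> J" for r \<theta> \<phi>
    using nonzero(1) that by blast
  have sf: "sin (f \<phi>) \<noteq> 0" if "\<phi> \<in> J" for \<phi>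
    using nonzero(2) that by blast
  have oR: "open R" and oI: "open I" and oJ: "open J" by (simp_all add: R_def I_def J_def)
  have pos: "0 < r" if "r \<in> R" for r using that dom by (auto simp: R_def)
  obtain r\<^sub>0 where r0: "r\<^sub>0 \<in> R" using dom dense unfolding R_def by (meson greaterThanLessThan_iff)
  obtain \<theta>\<^sub>0 where t0: "\<theta>\<^sub>0 \<in> I" using dom dense unfolding I_def by (meson greaterThanLessThan_iff)
  obtain \<phi>\<^sub>0 where p0: "\<phi>\<^sub>0 \<in> J" using dom dense unfolding J_def by (meson greaterThanLessThan_iff)
  have sinp: "sin \<phi> \<noteq> 0" if "\<phi> \<in> J" for \<phi> using that dom sin_gt_zero[of \<phi>] by fastforce
  define f1 where "f1 = deriv f"
  define f2 where "f2 = deriv (deriv f)"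
  define g1 where "g1 = deriv g"
  define g2 where "g2 = deriv (deriv g)"
  have jf: "jet2 f \<phi> (f1 \<phi>) (f2 \<phi>)" if "\<phi> \<in> J" for \<phi>
    unfolding f1_def f2_def
    by (intro twice_jet2 regular_where_nonzero(4)[of r\<^sub>0 \<theta>\<^sub>0]) (use that dom r0 t0 nz pos in auto)
  have jg: "jet2 g \<theta> (g1 \<theta>) (g2 \<theta>)" if "\<theta> \<in> I" for \<theta>
    unfolding g1_def g2_def
    by (intro twice_jet2 regular_where_nonzero(5)[of r\<^sub>0 _ \<phi>\<^sub>0]) (use that dom r0 p0 nz pos sf in auto)
  note df = jf[THEN jet2D] and dg = jg[THEN jet2D]
  have df1: "(f1 has_real_derivative f2 \<phi>) (at \<phi>)" if "\<phi> \<in> J" for \<phi>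
    using jet2_familyD[OF oJ that jf] .
  have dg1: "(g1 has_real_derivative g2 \<theta>) (at \<theta>)" if "\<theta> \<in> I" for \<theta>
    using jet2_familyD[OF oI that jg] .
  define sr where "sr r \<theta> \<phi> = deriv (\<lambda>\<rho>. s \<rho> \<theta> \<phi>) r" for r \<theta> \<phi>
  define srr where "srr r \<theta> \<phi> = deriv (deriv (\<lambda>\<rho>. s \<rho> \<theta> \<phi>)) r" for r \<theta> \<phi>
  define st where "st r \<theta> \<phi> = deriv (\<lambda>\<theta>. s r \<theta> \<phi>) \<theta>" for r \<theta> \<phi>
  define stt where "stt r \<theta> \<phi> = deriv (deriv (\<lambda>\<theta>. s r \<theta> \<phi>)) \<theta>" for r \<theta> \<phi>
  define sp where "sp r \<theta> \<phi> = deriv (\<lambda>\<phi>. s r \<theta> \<phi>) \<phi>" for r \<theta> \<phi>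
  define spp where "spp r \<theta> \<phi> = deriv (deriv (\<lambda>\<phi>. s r \<theta> \<phi>)) \<phi>" for r \<theta> \<phi>
  have js: "jet2 (\<lambda>\<rho>. s \<rho> \<theta> \<phi>) r (sr r \<theta> \<phi>) (srr r \<theta> \<phi>)"
    "jet2 (\<lambda>\<theta>. s r \<theta> \<phi>) \<theta> (st r \<theta> \<phi>) (stt r \<theta> \<phi>)"
    "jet2 (\<lambda>\<phi>. s r \<theta> \<phi>) \<phi> (sp r \<theta> \<phi>) (spp r \<theta> \<phi>)"
    if "r \<in> R" "\<theta> \<in> I" "\<phi> \<in> J" for r \<theta> \<phi>
    unfolding sr_def srr_def st_def stt_def sp_def spp_def
    using regular_where_nonzero(1-3)[OF pos[OF that(1)] subsetD[OF dom(5) that(2)]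
      subsetD[OF dom(6) that(3)] nz[OF that]] by (auto intro: twice_jet2)
  note eqs = frame_equations[OF pos subsetD[OF dom(5)] subsetD[OF dom(6)] js jf jg]
  have conf: "(f1 \<phi>)\<^sup>2 * (sin \<phi>)\<^sup>2 = (g1 \<theta>)\<^sup>2 * (sin (f \<phi>))\<^sup>2" if "\<theta> \<in> I" "\<phi> \<in> J" for \<theta> \<phi>
    using eqs(1)[OF r0 that r0 that r0 that r0 that that(2,1)]
      eqs(2)[OF r0 that r0 that r0 that r0 that that(2,1)] nz[OF r0 that] by simp
  show ?thesis
  proof (cases "\<exists>\<theta>\<in>I. g1 \<theta> = 0")
    case True
    then obtain \<theta> where "\<theta> \<in> I" "g1 \<theta> = 0" by blast
    then have f0: "f1 \<phi> = 0" if "\<phi> \<in> J" for \<phi> using conf that sinp by fastforce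
    then have g0: "g1 \<theta> = 0" if "\<theta> \<in> I" for \<theta> using conf[OF that p0] p0 sf by auto
    have "\<forall>\<theta>\<in>I. \<forall>\<theta>'\<in>I. g \<theta> = g \<theta>'"
      using zero_deriv_interval_constant[of a b g] dg g0 unfolding I_def by metis
    moreover have "\<forall>\<phi>\<in>J. \<forall>\<phi>'\<in>J. f \<phi> = f \<phi>'"
      using zero_deriv_interval_constant[of c d f] df f0 unfolding J_def by metis
    ultimately show ?thesis by blast
  next
    case False
    \<comment> \<open>Separation of variables: \<open>g1\<^sup>2\<close> is independent of \<open>\<theta>\<close>, with \<open>\<phi> = \<phi>\<^sub>0\<close> fixed in \<open>conf\<close>.\<close>
    define C where "C = (f1 \<phi>\<^sub>0)\<^sup>2 * (sin \<phi>\<^sub>0)\<^sup>2 / (sin (f \<phi>\<^sub>0))\<^sup>2"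
    have gC: "(g1 \<theta>)\<^sup>2 = C" if "\<theta> \<in> I" for \<theta>
      using conf[OF that p0] sf[OF p0] unfolding C_def by simp
    have fC: "(f1 \<phi>)\<^sup>2 * (sin \<phi>)\<^sup>2 = C * (sin (f \<phi>))\<^sup>2" if "\<phi> \<in> J" for \<phi>
      using conf[OF t0 that] gC[OF t0] by simp
    have f1: "f1 \<phi> \<noteq> 0" if "\<phi> \<in> J" for \<phi> using conf[OF t0 that] False t0 sf[OF that] by auto
    have g2: "g2 \<theta> = 0" if "\<theta> \<in> I" for \<theta>
    proof -
      have "((\<lambda>\<theta>. (g1 \<theta>)\<^sup>2) has_real_derivative 2 * g1 \<theta> * g2 \<theta>) (at \<theta>)"
        using dg1[OF that] by (auto intro!: derivative_eq_intros)
      from eq_on_open_deriv[OF oI that gC this DERIV_const] show ?thesis using False that by simp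
    qed
    obtain \<gamma> where \<gamma>: "\<And>\<theta>. \<theta> \<in> I \<Longrightarrow> g1 \<theta> = \<gamma>"
      using zero_deriv_interval_constant[of a b g1] dg1 g2 unfolding I_def by metis
    \<comment> \<open>The derivative of \<open>fC\<close>, divided by \<open>2 f1\<close>: the director is a harmonic map.\<close>
    have fC': "f2 \<phi> * (sin \<phi>)\<^sup>2 + f1 \<phi> * (sin \<phi> * cos \<phi>) = C * (sin (f \<phi>) * cos (f \<phi>))"
      if "\<phi> \<in> J" for \<phi>
    proof -
      have 1: "((\<lambda>\<phi>. (f1 \<phi>)\<^sup>2 * (sin \<phi>)\<^sup>2) has_real_derivative
          2 * f1 \<phi> * f2 \<phi> * (sin \<phi>)\<^sup>2 + (f1 \<phi>)\<^sup>2 * (2 * sin \<phi> * cos \<phi>)) (at \<phi>)"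
        using df1[OF that] by (auto intro!: derivative_eq_intros)
      have 2: "((\<lambda>\<phi>. C * (sin (f \<phi>))\<^sup>2) has_real_derivative
          C * (2 * sin (f \<phi>) * (cos (f \<phi>) * f1 \<phi>))) (at \<phi>)"
        using df[OF that] by (auto intro!: derivative_eq_intros)
      have "2 * f1 \<phi> * (f2 \<phi> * (sin \<phi>)\<^sup>2 + f1 \<phi> * (sin \<phi> * cos \<phi>) - C * (sin (f \<phi>) * cos (f \<phi>))) = 0"
        using eq_on_open_deriv[OF oJ that fC 1 2] by algebra
      then show ?thesis using f1[OF that] by simp
    qed
    \<comment> \<open>The remaining parts of the mixed equations say that \<open>s\<close> has zero angular derivatives.\<close>
    have st0: "st r \<theta> \<phi> = 0" and sp0: "sp r \<theta> \<phi> = 0" if "r \<in> R" "\<theta> \<in> I" "\<phi> \<in> J" for r \<theta> \<phi>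
    proof -
      have "sin (f \<phi>) * (2 * st r \<theta> \<phi> * g1 \<theta>) = 0"
        using eqs(4)[OF that that that that that(3,2)] g2 that by simp
      then show "st r \<theta> \<phi> = 0" using sf False that by auto
      have "2 * sp r \<theta> \<phi> * f1 \<phi> * (sin \<phi>)\<^sup>2 = 0"
        using eqs(3)[OF that that that that that(3,2)] fC' gC that by simp
      then show "sp r \<theta> \<phi> = 0" using sinp f1 that by auto
    qed
    have s_const: "s r \<theta> \<phi> = s r \<theta>' \<phi>'"
      if "r \<in> R" "\<theta> \<in> I" "\<phi> \<in> J" "\<theta>' \<in> I" "\<phi>' \<in> J" for r \<theta> \<phi> \<theta>' \<phi>'
    proof -
      have "s r \<theta> \<phi> = s r \<theta>' \<phi>"
        using zero_deriv_interval_constant[of a b "\<lambda>\<theta>. s r \<theta> \<phi>"] js(2)[THEN jet2D] st0 that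
        unfolding I_def by metis
      also have "\<dots> = s r \<theta>' \<phi>'"
        using zero_deriv_interval_constant[of c d "\<lambda>\<phi>. s r \<theta>' \<phi>"] js(3)[THEN jet2D] sp0 that
        unfolding J_def by metis
      finally show ?thesis .
    qed
    \<comment> \<open>As \<open>s\<close> is radial on the whole box, the coefficient \<open>K\<close> below does not depend on \<open>\<phi>\<close>.\<close>
    have radial: "sr r\<^sub>0 \<theta>\<^sub>0 \<phi> = sr r\<^sub>0 \<theta>\<^sub>0 \<phi>\<^sub>0" "srr r\<^sub>0 \<theta>\<^sub>0 \<phi> = srr r\<^sub>0 \<theta>\<^sub>0 \<phi>\<^sub>0" if "\<phi> \<in> J" for \<phi>
    proof -
      have "\<forall>\<^sub>F r in nhds r\<^sub>0. s r \<theta>\<^sub>0 \<phi> = s r \<theta>\<^sub>0 \<phi>\<^sub>0"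
        using eventually_nhds_in_open[OF oR r0] by eventually_elim (use s_const t0 p0 that in blast)
      from jet2_cong[OF js(1)[OF r0 t0 p0] this] js(1)[OF r0 t0 that]
      show "sr r\<^sub>0 \<theta>\<^sub>0 \<phi> = sr r\<^sub>0 \<theta>\<^sub>0 \<phi>\<^sub>0" "srr r\<^sub>0 \<theta>\<^sub>0 \<phi> = srr r\<^sub>0 \<theta>\<^sub>0 \<phi>\<^sub>0"
        using jet2_unique by blast+
    qed
    have angular: "stt r\<^sub>0 \<theta>\<^sub>0 \<phi> = 0" "spp r\<^sub>0 \<theta>\<^sub>0 \<phi> = 0" if "\<phi> \<in> J" for \<phi>
    proof -
      have "\<forall>\<^sub>F \<theta> in nhds \<theta>\<^sub>0. s r\<^sub>0 \<theta> \<phi> = s r\<^sub>0 \<theta>\<^sub>0 \<phi>\<^sub>0"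
        using eventually_nhds_in_open[OF oI t0]
        by eventually_elim (use s_const t0 p0 r0 that in blast)
      from jet2_cong[OF jet2_const this] show "stt r\<^sub>0 \<theta>\<^sub>0 \<phi> = 0"
        using js(2)[OF r0 t0 that] jet2_unique by blast
      have "\<forall>\<^sub>F \<phi>' in nhds \<phi>. s r\<^sub>0 \<theta>\<^sub>0 \<phi>' = s r\<^sub>0 \<theta>\<^sub>0 \<phi>\<^sub>0"
        using eventually_nhds_in_open[OF oJ that]
        by eventually_elim (use s_const t0 p0 r0 that in blast)
      from jet2_cong[OF jet2_const this] show "spp r\<^sub>0 \<theta>\<^sub>0 \<phi> = 0"
        using js(3)[OF r0 t0 that] jet2_unique by blast
    qed
    define S where "S = s r\<^sub>0 \<theta>\<^sub>0 \<phi>\<^sub>0"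
    define K where "K = r\<^sub>0\<^sup>2 * srr r\<^sub>0 \<theta>\<^sub>0 \<phi>\<^sub>0 + 2 * r\<^sub>0 * sr r\<^sub>0 \<theta>\<^sub>0 \<phi>\<^sub>0 - r\<^sub>0\<^sup>2 * bulk t S"
    have S0: "S \<noteq> 0" unfolding S_def using nz r0 t0 p0 by blast
    have fK: "(f1 \<phi>)\<^sup>2 = K / (6 * S)" if "\<phi> \<in> J" for \<phi>
    proof -
      have "s r\<^sub>0 \<theta>\<^sub>0 \<phi> = S" unfolding S_def using s_const r0 t0 p0 that by blast
      then have "(sin \<phi>)\<^sup>2 * K = (sin \<phi>)\<^sup>2 * (6 * S * (f1 \<phi>)\<^sup>2)"
        using eqs(1)[OF r0 t0 that r0 t0 that r0 t0 that r0 t0 that that t0]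
        by (simp add: K_def radial[OF that] angular[OF that] sp0[OF r0 t0 that] algebra_simps)
      then show ?thesis using sinp[OF that] S0 by (simp add: field_simps)
    qed
    have f2: "f2 \<phi> = 0" if "\<phi> \<in> J" for \<phi>
    proof -
      have "((\<lambda>\<phi>. (f1 \<phi>)\<^sup>2) has_real_derivative 2 * f1 \<phi> * f2 \<phi>) (at \<phi>)"
        using df1[OF that] by (auto intro!: derivative_eq_intros)
      from eq_on_open_deriv[OF oJ that fK this DERIV_const] show ?thesis using f1 that by simp
    qed
    obtain \<kappa> where \<kappa>: "\<And>\<phi>. \<phi> \<in> J \<Longrightarrow> f1 \<phi> = \<kappa>"
      using zero_deriv_interval_constant[of c d f1] df1 f2 unfolding J_def by metis
    have \<kappa>0: "\<kappa> \<noteq> 0" using f1 \<kappa> p0 by blast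
    \<comment> \<open>Up to constant factors, each of \<open>e1\<close>, \<open>e2\<close>, \<open>e3\<close> is the derivative of the identity before it.\<close>
    have e0: "\<kappa>\<^sup>2 * (sin \<phi>)\<^sup>2 = C * (sin (f \<phi>))\<^sup>2" if "\<phi> \<in> J" for \<phi>
      using fC[OF that] \<kappa>[OF that] by simp
    have e1: "\<kappa> * (sin \<phi> * cos \<phi>) = C * (sin (f \<phi>) * cos (f \<phi>))" if "\<phi> \<in> J" for \<phi>
      using fC'[OF that] f2[OF that] \<kappa>[OF that] by simp
    have df': "(f has_real_derivative \<kappa>) (at \<phi>)" if "\<phi> \<in> J" for \<phi>
      using df[OF that] \<kappa>[OF that] by simp
    have e2: "(cos \<phi>)\<^sup>2 - (sin \<phi>)\<^sup>2 = C * ((cos (f \<phi>))\<^sup>2 - (sin (f \<phi>))\<^sup>2)" if "\<phi> \<in> J" for \<phi>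
    proof -
      have 1: "((\<lambda>\<phi>. \<kappa> * (sin \<phi> * cos \<phi>)) has_real_derivative \<kappa> * ((cos \<phi>)\<^sup>2 - (sin \<phi>)\<^sup>2)) (at \<phi>)"
        by (auto intro!: derivative_eq_intros simp: power2_eq_square)
      have 2: "((\<lambda>\<phi>. C * (sin (f \<phi>) * cos (f \<phi>))) has_real_derivative
          C * (((cos (f \<phi>))\<^sup>2 - (sin (f \<phi>))\<^sup>2) * \<kappa>)) (at \<phi>)"
        using df'[OF that] by (auto intro!: derivative_eq_intros simp: power2_eq_square algebra_simps)
      show ?thesis using eq_on_open_deriv[OF oJ that e1 1 2] \<kappa>0 by simp
    qed
    have e3: "sin \<phi> * cos \<phi> = C * (sin (f \<phi>) * cos (f \<phi>)) * \<kappa>" if "\<phi> \<in> J" for \<phi>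
    proof -
      have 1: "((\<lambda>\<phi>. (cos \<phi>)\<^sup>2 - (sin \<phi>)\<^sup>2) has_real_derivative - 4 * (sin \<phi> * cos \<phi>)) (at \<phi>)"
        by (auto intro!: derivative_eq_intros)
      have 2: "((\<lambda>\<phi>. C * ((cos (f \<phi>))\<^sup>2 - (sin (f \<phi>))\<^sup>2)) has_real_derivative
          - 4 * (C * (sin (f \<phi>) * cos (f \<phi>)) * \<kappa>)) (at \<phi>)"
        using df'[OF that] by (auto intro!: derivative_eq_intros)
      show ?thesis using eq_on_open_deriv[OF oJ that e2 1 2] by simp
    qed
    have \<kappa>1: "\<kappa>\<^sup>2 = 1"
    proof -
      \<comment> \<open>\<open>e1\<close> and \<open>e3\<close> give \<open>\<kappa>\<^sup>2 = 1\<close> where \<open>sin \<phi> cos \<phi> \<noteq> 0\<close>, that is, away from the equator.\<close>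
      obtain \<phi> where \<phi>: "\<phi> \<in> J" "\<phi> \<noteq> pi / 2"
      proof (cases "\<phi>\<^sub>0 = pi / 2")
        case True
        obtain \<phi> where "\<phi>\<^sub>0 < \<phi>" "\<phi> < d" using p0 dense unfolding J_def by auto
        then show ?thesis using that[of \<phi>] True p0 unfolding J_def by auto
      qed (use that p0 in auto)
      have "cos \<phi> \<noteq> 0"
      proof
        assume "cos \<phi> = 0"
        then have "cos \<phi> = cos (pi / 2)" by simp
        moreover have "0 \<le> \<phi>" "\<phi> \<le> pi" using \<phi>(1) dom(6) by auto
        ultimately show False using cos_inj_pi[of \<phi> "pi / 2"] \<phi>(2) by simp
      qed
      moreover have "sin \<phi> * cos \<phi> = \<kappa>\<^sup>2 * (sin \<phi> * cos \<phi>)"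
        using e1[OF \<phi>(1)] e3[OF \<phi>(1)] by algebra
      ultimately show ?thesis using sinp[OF \<phi>(1)] by simp
    qed
    have C1: "C = 1"
      using e0[OF p0] e2[OF p0] \<kappa>1 sin_cos_squared_add[of \<phi>\<^sub>0] sin_cos_squared_add[of "f \<phi>\<^sub>0"]
      by algebra
    have "\<gamma>\<^sup>2 = 1" using gC[OF t0] \<gamma>[OF t0] C1 by simp
    moreover have "\<forall>\<phi>\<in>J. jet2 f \<phi> \<kappa> 0 \<and> (sin (f \<phi>))\<^sup>2 = (sin \<phi>)\<^sup>2"
      using jf \<kappa> f2 e0 \<kappa>1 C1 by fastforce
    moreover have "\<forall>\<theta>\<in>I. jet2 g \<theta> \<gamma> 0"
      using jg \<gamma> g2 by fastforce
    ultimately show ?thesis using \<kappa>1 s_const by blast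
  qed
qed

end

section \<open>Spherical coordinates\<close>

lemma continuous_on_vecI:
  fixes h :: "'a::topological_space \<Rightarrow> 'b::topological_space^'n"
  assumes "\<And>i. continuous_on S (\<lambda>x. h x $ i)"
  shows "continuous_on S h"
  using continuous_on_vec_lambda[of S "\<lambda>i x. h x $ i"] assms by simp

lemma continuous_on_direction:
  fixes S :: "'a::t2_space set"
  assumes "continuous_on S u" "continuous_on S v"
  shows "continuous_on S (\<lambda>x. direction (u x) (v x))"
proof (rule continuous_on_vecI)
  have "\<forall>i. continuous_on S (\<lambda>x. direction (u x) (v x) $ i)"
    unfolding forall_3 direction_def vector_3 by (intro conjI continuous_intros assms)
  then show "continuous_on S (\<lambda>x. direction (u x) (v x) $ i)" for i by blast
qed

lemma continuous_on_spherical: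
  fixes S :: "'a::t2_space set"
  assumes "continuous_on S u" "continuous_on S v" "continuous_on S w"
  shows "continuous_on S (\<lambda>x. spherical (u x) (v x) (w x))"
proof (rule continuous_on_vecI)
  have "\<forall>i. continuous_on S (\<lambda>x. spherical (u x) (v x) (w x) $ i)"
    unfolding forall_3 spherical_def vector_3 by (intro conjI continuous_intros assms)
  then show "continuous_on S (\<lambda>x. spherical (u x) (v x) (w x) $ i)" for i by blast
qed

lemma open_real_interval:
  assumes "open A" "x \<in> A"
  obtains a b :: real where "x \<in> {a<..<b}" "{a<..<b} \<subseteq> A"
proof -
  obtain e where "e > 0" "ball x e \<subseteq> A" using assms open_contains_ball by blast
  then show ?thesis using that[of "x - e" "x + e"] by (simp add: ball_eq_greaterThanLessThan)
qed

definition azimuth :: "real^3 \<Rightarrow> real" where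
  "azimuth x = Arg2pi (Complex (x $ 1) (x $ 2))"

definition polar_angle :: "real^3 \<Rightarrow> real" where
  "polar_angle x = arccos (x $ 3 / norm x)"

lemma spherical_coordinates:
  "azimuth x \<in> {0..<2 * pi}" "polar_angle x \<in> {0..pi}"
  "spherical (norm x) (azimuth x) (polar_angle x) = x"
proof -
  show "azimuth x \<in> {0..<2 * pi}"
    using Arg2pi_ge_0 Arg2pi_lt_2pi by (simp add: azimuth_def)
  have le: "\<bar>x $ 3\<bar> \<le> norm x" using component_le_norm_cart by blast
  then have b: "- 1 \<le> x $ 3 / norm x" "x $ 3 / norm x \<le> 1"
    by (cases "norm x = 0"; auto simp: field_simps abs_le_iff)+
  then show "polar_angle x \<in> {0..pi}"
    unfolding polar_angle_def using arccos_bounded by auto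
  have c: "norm x * cos (polar_angle x) = x $ 3"
    using b le by (cases "norm x = 0") (auto simp: polar_angle_def cos_arccos)
  have sp: "0 \<le> sin (polar_angle x)"
    using \<open>polar_angle x \<in> {0..pi}\<close> by (simp add: sin_ge_zero)
  let ?z = "Complex (x $ 1) (x $ 2)"
  have nx: "(norm x)\<^sup>2 = (x $ 1)\<^sup>2 + (x $ 2)\<^sup>2 + (x $ 3)\<^sup>2"
    unfolding power2_norm_eq_inner inner_vec_def sum_3 by (simp add: power2_eq_square)
  have "(norm x * sin (polar_angle x))\<^sup>2 = (norm x)\<^sup>2 - (norm x * cos (polar_angle x))\<^sup>2"
    by (simp add: power_mult_distrib sin_squared_eq right_diff_distrib)
  also have "\<dots> = (cmod ?z)\<^sup>2" unfolding c nx cmod_power2 by simp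
  finally have s: "norm x * sin (polar_angle x) = cmod ?z"
    using sp by (simp add: power2_eq_iff_nonneg)
  have z: "?z = of_real (cmod ?z) * exp (\<i> * of_real (azimuth x))"
    unfolding azimuth_def by (rule Arg2pi_eq)
  have "x $ 1 = cmod ?z * cos (azimuth x)" "x $ 2 = cmod ?z * sin (azimuth x)"
    using arg_cong[OF z, of Re] arg_cong[OF z, of Im] by (simp_all add: Re_exp Im_exp)
  then have "\<forall>i. spherical (norm x) (azimuth x) (polar_angle x) $ i = x $ i"
    unfolding forall_3 spherical_nth using c s by (intro conjI; algebra)
  then show "spherical (norm x) (azimuth x) (polar_angle x) = x" by (simp add: vec_eq_iff)
qed

lemma spherical_coordinates_interior:
  assumes "x $ 2 \<noteq> 0"
  shows "0 < norm x" "azimuth x \<in> {0<..<2 * pi}" "polar_angle x \<in> {0<..<pi}"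
proof -
  have x2: "x $ 2 = norm x * sin (azimuth x) * sin (polar_angle x)"
    using spherical_coordinates(3)[of x] spherical_nth(2) by metis
  show "0 < norm x" using assms by auto
  show "azimuth x \<in> {0<..<2 * pi}"
    using spherical_coordinates(1)[of x] x2 assms by (cases "azimuth x = 0") auto
  show "polar_angle x \<in> {0<..<pi}"
    using spherical_coordinates(2)[of x] x2 assms
    by (cases "polar_angle x = 0"; cases "polar_angle x = pi") auto
qed

text \<open>The plane \<open>x\<^sub>2 = 0\<close> contains both the axis and the half-plane across which the azimuth jumps, so its
complement is an open set on which the coordinates are continuous.\<close>

lemma isCont_spherical_coordinates:
  assumes "x $ 2 \<noteq> 0"
  shows "isCont azimuth x" "isCont polar_angle x"
proof -
  have "isCont Arg2pi (Complex (x $ 1) (x $ 2))"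
    using assms by (intro continuous_at_Arg2pi) (auto simp: complex_nonneg_Reals_iff)
  moreover have "isCont (\<lambda>x::real^3. Complex (x $ 1) (x $ 2)) x"
    unfolding Complex_eq by (intro continuous_intros)
  ultimately show "isCont azimuth x"
    unfolding azimuth_def[abs_def] by (rule isCont_o2[rotated])
  have "isCont arccos (x $ 3 / norm x)"
  proof (rule isCont_arccos)
    have "polar_angle x \<in> {0<..<pi}" using spherical_coordinates_interior[OF assms] by blast
    moreover have "x $ 3 / norm x = cos (polar_angle x)"
      using spherical_nth(3)[of "norm x" "azimuth x" "polar_angle x"] spherical_coordinates(3)[of x]
        spherical_coordinates_interior(1)[OF assms] by (simp add: field_simps)
    moreover have "- 1 < cos (polar_angle x)" "cos (polar_angle x) < 1"
      using calculation(1) cos_monotone_0_pi[of "polar_angle x" pi] cos_monotone_0_pi[of 0 "polar_angle x"]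
      by auto
    ultimately show "- 1 < x $ 3 / norm x" "x $ 3 / norm x < 1" by simp_all
  qed
  moreover have "isCont (\<lambda>x::real^3. x $ 3 / norm x) x"
    using assms by (intro continuous_intros) auto
  ultimately show "isCont polar_angle x"
    unfolding polar_angle_def[abs_def] by (rule isCont_o2[rotated])
qed

section \<open>Propagation over spheres\<close>

context separated_uniaxial
begin

lemma continuous_Q_nth: "continuous_on UNIV (\<lambda>x. Q x $ i $ j)"
  using Q_C2[of i j] unfolding C2_def C1_def
  by (simp add: continuous_on_eq_continuous_at differentiable_imp_continuous_within)

lemma continuous_Q: "continuous_on UNIV Q"
  by (intro continuous_on_vecI continuous_Q_nth)

lemma s_eq_contraction:
  assumes "0 \<le> r" "\<theta> \<in> {0..<2 * pi}" "\<phi> \<in> {0..pi}"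
  shows "s r \<theta> \<phi> = 3 / 2 * (direction (f \<phi>) (g \<theta>) \<bullet> (Q (spherical r \<theta> \<phi>) *v direction (f \<phi>) (g \<theta>)))"
proof -
  have "direction (f \<phi>) (g \<theta>) \<bullet> direction (f \<phi>) (g \<theta>) = 1"
    using norm_direction norm_eq_1 by blast
  then show ?thesis using assms by (simp add: Q_spherical inner_uniaxial)
qed

text \<open>Unlike the rational expression for the scalar order, the formula \<open>s = (3/2) n \<bullet> Q n\<close> gives continuity across the zeros of
\<open>s\<close>; it uses that \<open>f\<close> and \<open>g\<close> are continuous.\<close>

lemma continuous_s:
  "continuous_on ({0..} \<times> {0..<2 * pi} \<times> {0..pi}) (\<lambda>(r, \<theta>, \<phi>). s r \<theta> \<phi>)"
proof -
  let ?D = "{0..} \<times> {0..<2 * pi} \<times> {0..pi}"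
  let ?n = "\<lambda>p::real \<times> real \<times> real. direction (f (snd (snd p))) (g (fst (snd p)))"
  have "continuous_on ?D (\<lambda>p. f (snd (snd p)))" "continuous_on ?D (\<lambda>p. g (fst (snd p)))"
    by (rule continuous_on_compose2[OF cont_f] continuous_on_compose2[OF cont_g];
        (intro continuous_intros | force))+
  then have n: "continuous_on ?D ?n" by (rule continuous_on_direction)
  have Q: "continuous_on ?D (\<lambda>p. Q (spherical (fst p) (fst (snd p)) (snd (snd p))) $ i $ j)" for i j
    by (rule continuous_on_compose2[OF continuous_Q_nth])
       (auto intro!: continuous_on_spherical continuous_intros)
  have "continuous_on ?D (\<lambda>p. 3 / 2 * (?n p \<bullet> (Q (spherical (fst p) (fst (snd p)) (snd (snd p))) *v ?n p)))"
    unfolding inner_matrix_vector by (intro continuous_intros Q n)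
  then show ?thesis
    by (rule continuous_on_eq) (auto simp: s_eq_contraction)
qed

lemma continuous_on_s:
  assumes "continuous_on A u" "continuous_on A v" "continuous_on A w"
    and range: "\<And>x. x \<in> A \<Longrightarrow> 0 \<le> u x \<and> v x \<in> {0..<2 * pi} \<and> w x \<in> {0..pi}"
  shows "continuous_on A (\<lambda>x. s (u x) (v x) (w x))"
proof -
  have "continuous_on A (\<lambda>x. case (u x, v x, w x) of (r, \<theta>, \<phi>) \<Rightarrow> s r \<theta> \<phi>)"
    by (rule continuous_on_compose2[OF continuous_s])
       (intro continuous_on_Pair assms, use range in \<open>auto simp: image_subset_iff\<close>)
  then show ?thesis by simp
qed

lemma nonzero_box:
  assumes "0 < r" "\<theta> \<in> {0<..<2 * pi}" "\<phi> \<in> V" "open V" "V \<subseteq> {0<..<pi}" and nz: "s r \<theta> \<phi> \<noteq> 0"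
  obtains r\<^sub>1 r\<^sub>2 a b c d where "0 \<le> r\<^sub>1" "r \<in> {r\<^sub>1<..<r\<^sub>2}" "\<theta> \<in> {a<..<b}" "\<phi> \<in> {c<..<d}"
    "{a<..<b} \<subseteq> {0<..<2 * pi}" "{c<..<d} \<subseteq> V"
    "\<forall>r'\<in>{r\<^sub>1<..<r\<^sub>2}. \<forall>\<theta>'\<in>{a<..<b}. \<forall>\<phi>'\<in>{c<..<d}. s r' \<theta>' \<phi>' \<noteq> 0"
proof -
  let ?H = "\<lambda>p. Q (spherical (fst p) (fst (snd p)) (snd (snd p)))"
  have "continuous_on UNIV ?H"
    by (rule continuous_on_compose2[OF continuous_Q])
       (auto intro!: continuous_on_spherical continuous_intros)
  then have "open {p. ?H p \<noteq> 0}" by (intro open_Collect_neq continuous_on_const)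
  moreover have "(r, \<theta>, \<phi>) \<in> {p. ?H p \<noteq> 0}"
    using assms by (auto simp: Q_spherical uniaxial_eq_0_iff norm_direction)
  ultimately obtain A B where A: "open A" "open B" "(r, \<theta>, \<phi>) \<in> A \<times> B" "A \<times> B \<subseteq> {p. ?H p \<noteq> 0}"
    by (rule open_prod_elim)
  have "(\<theta>, \<phi>) \<in> B" using A(3) by simp
  with A(2) obtain B1 B2 where B: "open B1" "open B2" "(\<theta>, \<phi>) \<in> B1 \<times> B2" "B1 \<times> B2 \<subseteq> B"
    by (rule open_prod_elim)
  obtain r\<^sub>1 r\<^sub>2 where r: "r \<in> {r\<^sub>1<..<r\<^sub>2}" "{r\<^sub>1<..<r\<^sub>2} \<subseteq> A \<inter> {0<..}"
    by (rule open_real_interval[of "A \<inter> {0<..}" r]) (use A assms in auto)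
  obtain a b where ab: "\<theta> \<in> {a<..<b}" "{a<..<b} \<subseteq> B1 \<inter> {0<..<2 * pi}"
    by (rule open_real_interval[of "B1 \<inter> {0<..<2 * pi}" \<theta>]) (use B assms in auto)
  obtain c d where cd: "\<phi> \<in> {c<..<d}" "{c<..<d} \<subseteq> B2 \<inter> V"
    by (rule open_real_interval[of "B2 \<inter> V" \<phi>]) (use B assms in auto)
  have "0 \<le> r\<^sub>1"
  proof (rule ccontr)
    assume "\<not> 0 \<le> r\<^sub>1"
    then have "0 \<in> {r\<^sub>1<..<r\<^sub>2}" using assms(1) r(1) by auto
    then show False using r(2) by auto
  qed
  moreover have "s r' \<theta>' \<phi>' \<noteq> 0" if "r' \<in> {r\<^sub>1<..<r\<^sub>2}" "\<theta>' \<in> {a<..<b}" "\<phi>' \<in> {c<..<d}" for r' \<theta>' \<phi>'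
  proof -
    have 1: "r' \<in> A" "0 < r'" using that(1) r(2) by auto
    have 2: "\<theta>' \<in> B1" "\<theta>' \<in> {0<..<2 * pi}" using that(2) ab(2) by auto
    have 3: "\<phi>' \<in> B2" "\<phi>' \<in> {0<..<pi}" using that(3) cd(2) assms(5) by blast+
    have "(r', \<theta>', \<phi>') \<in> A \<times> B" using 1 2 3 B(4) by blast
    then have "Q (spherical r' \<theta>' \<phi>') \<noteq> 0" using A(4) by force
    then show ?thesis using 1 2 3 by (auto simp: Q_spherical uniaxial_eq_0_iff norm_direction)
  qed
  ultimately show ?thesis using that r(1) ab cd by blast
qed

text \<open>The second alternative of \<open>box_dichotomy\<close> at one point. The zero second derivatives are included because
they show later that the slopes \<open>\<kappa>\<close> and \<open>\<gamma>\<close>, which may depend on the point here, do not change.\<close>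

definition rigid :: "real \<Rightarrow> real \<Rightarrow> real \<Rightarrow> bool" where
  "rigid r \<theta> \<phi> \<longleftrightarrow> s r \<theta> \<phi> \<noteq> 0 \<and> (sin (f \<phi>))\<^sup>2 = (sin \<phi>)\<^sup>2 \<and>
     (\<exists>\<kappa>. \<kappa>\<^sup>2 = 1 \<and> jet2 f \<phi> \<kappa> 0) \<and> (\<exists>\<gamma>. \<gamma>\<^sup>2 = 1 \<and> jet2 g \<theta> \<gamma> 0)"

text \<open>Rigidity and local constancy of the director exclude each other, since \<open>g\<close> has a nonzero derivative at a rigid
point. Hence the dichotomy decides rigidity for a whole box at once.\<close>

lemma rigid_box:
  assumes "0 < r" "\<theta> \<in> {0<..<2 * pi}" "\<phi> \<in> {0<..<pi}" "s r \<theta> \<phi> \<noteq> 0" "sin (f \<phi>) \<noteq> 0"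
  obtains a b c d where "\<theta> \<in> {a<..<b}" "\<phi> \<in> {c<..<d}" "{a<..<b} \<subseteq> {0<..<2 * pi}" "{c<..<d} \<subseteq> {0<..<pi}"
    "(\<forall>\<theta>'\<in>{a<..<b}. \<forall>\<phi>'\<in>{c<..<d}. \<not> rigid r \<theta>' \<phi>') \<or>
     (\<forall>\<theta>'\<in>{a<..<b}. \<forall>\<phi>'\<in>{c<..<d}. rigid r \<theta>' \<phi>' \<and> s r \<theta>' \<phi>' = s r \<theta> \<phi>)"
proof -
  let ?V = "{\<phi> \<in> {0<..<pi}. sin (f \<phi>) \<noteq> 0}"
  have "continuous_on {0<..<pi} (\<lambda>\<phi>. sin (f \<phi>))"
    by (intro continuous_intros continuous_on_subset[OF cont_f]) auto
  then have "open ({0<..<pi} \<inter> (\<lambda>\<phi>. sin (f \<phi>)) -` (- {0}))"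
    by (intro continuous_open_preimage) auto
  also have "{0<..<pi} \<inter> (\<lambda>\<phi>. sin (f \<phi>)) -` (- {0}) = ?V" by auto
  finally have V: "open ?V" .
  have "\<phi> \<in> ?V" using assms by simp
  obtain r\<^sub>1 r\<^sub>2 a b c d where box: "0 \<le> r\<^sub>1" "r \<in> {r\<^sub>1<..<r\<^sub>2}" "\<theta> \<in> {a<..<b}" "\<phi> \<in> {c<..<d}"
    "{a<..<b} \<subseteq> {0<..<2 * pi}" "{c<..<d} \<subseteq> ?V"
    "\<forall>r'\<in>{r\<^sub>1<..<r\<^sub>2}. \<forall>\<theta>'\<in>{a<..<b}. \<forall>\<phi>'\<in>{c<..<d}. s r' \<theta>' \<phi>' \<noteq> 0"
    by (rule nonzero_box[OF assms(1,2) \<open>\<phi> \<in> ?V\<close> V _ assms(4)]) blast+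
  have J: "{c<..<d} \<subseteq> {0<..<pi}" using box(6) by blast
  have lt: "r\<^sub>1 < r\<^sub>2" "a < b" "c < d" using box(2-4) by auto
  have sf: "\<forall>\<phi>\<in>{c<..<d}. sin (f \<phi>) \<noteq> 0" using box(6) by blast
  consider "\<forall>\<theta>\<in>{a<..<b}. \<forall>\<theta>'\<in>{a<..<b}. g \<theta> = g \<theta>'"
    | \<kappa> \<gamma> where "\<kappa>\<^sup>2 = 1" "\<gamma>\<^sup>2 = 1"
       "\<forall>\<phi>\<in>{c<..<d}. jet2 f \<phi> \<kappa> 0 \<and> (sin (f \<phi>))\<^sup>2 = (sin \<phi>)\<^sup>2" "\<forall>\<theta>\<in>{a<..<b}. jet2 g \<theta> \<gamma> 0"
       "\<forall>r\<in>{r\<^sub>1<..<r\<^sub>2}. \<forall>\<theta>\<in>{a<..<b}. \<forall>\<phi>\<in>{c<..<d}. \<forall>\<theta>'\<in>{a<..<b}. \<forall>\<phi>'\<in>{c<..<d}. s r \<theta> \<phi> = s r \<theta>' \<phi>'"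
    using box_dichotomy[OF box(1) lt box(5) J box(7) sf] by (elim disjE conjE exE) blast+
  then have "(\<forall>\<theta>'\<in>{a<..<b}. \<forall>\<phi>'\<in>{c<..<d}. \<not> rigid r \<theta>' \<phi>') \<or>
     (\<forall>\<theta>'\<in>{a<..<b}. \<forall>\<phi>'\<in>{c<..<d}. rigid r \<theta>' \<phi>' \<and> s r \<theta>' \<phi>' = s r \<theta> \<phi>)"
  proof cases
    case 1
    have "\<not> rigid r \<theta>' \<phi>'" if "\<theta>' \<in> {a<..<b}" for \<theta>' \<phi>'
    proof
      assume "rigid r \<theta>' \<phi>'"
      then obtain \<gamma> where \<gamma>: "\<gamma>\<^sup>2 = 1" "jet2 g \<theta>' \<gamma> 0" unfolding rigid_def by blast
      have "g y = g \<theta>'" if "y \<in> {a<..<b}" for y using 1 that \<open>\<theta>' \<in> {a<..<b}\<close> by blast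
      from eq_on_open_deriv[OF open_greaterThanLessThan that this jet2D[OF \<gamma>(2)] DERIV_const]
      show False using \<gamma>(1) by simp
    qed
    then show ?thesis by blast
  next
    case 2
    have "rigid r \<theta>' \<phi>' \<and> s r \<theta>' \<phi>' = s r \<theta> \<phi>" if in_box: "\<theta>' \<in> {a<..<b}" "\<phi>' \<in> {c<..<d}" for \<theta>' \<phi>'
    proof -
      have "s r \<theta>' \<phi>' = s r \<theta> \<phi>" using 2(5) box(2-4) in_box by blast
      moreover have "s r \<theta>' \<phi>' \<noteq> 0" using box(2,7) in_box by blast
      ultimately show ?thesis unfolding rigid_def using 2(1-4) in_box by blast
    qed
    then show ?thesis by blast
  qed
  then show ?thesis using that[OF box(3,4,5) J] by blast
qed

text \<open>The rigid points with the given value of \<open>s\<close> form an open and closed subset \<open>T\<close> of the coordinate rectangle.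
At a limit point of \<open>T\<close>, continuity preserves the value \<open>s \<noteq> 0\<close> and the identity \<open>sin\<^sup>2 f = sin\<^sup>2 \<phi>\<close>,
and the latter keeps \<open>sin f\<close> away from \<open>0\<close> in the open rectangle, so \<open>rigid_box\<close> applies there.\<close>

lemma rigid_everywhere:
  assumes r: "0 < r" and "\<theta>\<^sub>0 \<in> {0<..<2 * pi}" "\<phi>\<^sub>0 \<in> {0<..<pi}" "rigid r \<theta>\<^sub>0 \<phi>\<^sub>0"
    and "\<theta> \<in> {0<..<2 * pi}" "\<phi> \<in> {0<..<pi}"
  shows "rigid r \<theta> \<phi>" "s r \<theta> \<phi> = s r \<theta>\<^sub>0 \<phi>\<^sub>0"
proof -
  define s\<^sub>0 where "s\<^sub>0 = s r \<theta>\<^sub>0 \<phi>\<^sub>0"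
  let ?D = "{0<..<2 * pi} \<times> {0<..<pi}"
  define T where "T = {p \<in> ?D. rigid r (fst p) (snd p) \<and> s r (fst p) (snd p) = s\<^sub>0}"
  have s0: "s\<^sub>0 \<noteq> 0" using assms(4) by (simp add: rigid_def s\<^sub>0_def)
  have box: "\<exists>W. open W \<and> p \<in> W \<and> W \<subseteq> ?D \<and> (W \<subseteq> T \<or> W \<inter> T = {})"
    if p: "p \<in> ?D" "s r (fst p) (snd p) = s\<^sub>0" "(sin (f (snd p)))\<^sup>2 = (sin (snd p))\<^sup>2" for p
  proof -
    have "sin (snd p) \<noteq> 0" using p(1) sin_gt_zero[of "snd p"] by auto
    then have sf: "sin (f (snd p)) \<noteq> 0" using p(3) by auto
    have dom: "fst p \<in> {0<..<2 * pi}" "snd p \<in> {0<..<pi}" "s r (fst p) (snd p) \<noteq> 0"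
      using p s0 by auto
    obtain a b c d where b: "fst p \<in> {a<..<b}" "snd p \<in> {c<..<d}" "{a<..<b} \<subseteq> {0<..<2 * pi}" "{c<..<d} \<subseteq> {0<..<pi}"
      "(\<forall>\<theta>'\<in>{a<..<b}. \<forall>\<phi>'\<in>{c<..<d}. \<not> rigid r \<theta>' \<phi>') \<or>
       (\<forall>\<theta>'\<in>{a<..<b}. \<forall>\<phi>'\<in>{c<..<d}. rigid r \<theta>' \<phi>' \<and> s r \<theta>' \<phi>' = s r (fst p) (snd p))"
      by (rule rigid_box[OF r dom sf])
    define W where "W = {a<..<b} \<times> {c<..<d}"
    have sub: "W \<subseteq> ?D" unfolding W_def using b(3,4) by blast
    have "W \<subseteq> T \<or> W \<inter> T = {}"
      using b(5)
    proof
      assume 1: "\<forall>\<theta>'\<in>{a<..<b}. \<forall>\<phi>'\<in>{c<..<d}. \<not> rigid r \<theta>' \<phi>'"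
      have "q \<notin> T" if "q \<in> W" for q
      proof -
        have "fst q \<in> {a<..<b}" "snd q \<in> {c<..<d}"
          using that by (simp_all only: mem_Times_iff W_def)
        then have "\<not> rigid r (fst q) (snd q)" using 1 by blast
        then show ?thesis unfolding T_def by simp
      qed
      then show ?thesis by blast
    next
      assume 2: "\<forall>\<theta>'\<in>{a<..<b}. \<forall>\<phi>'\<in>{c<..<d}. rigid r \<theta>' \<phi>' \<and> s r \<theta>' \<phi>' = s r (fst p) (snd p)"
      have "q \<in> T" if "q \<in> W" for q
      proof -
        have "fst q \<in> {a<..<b}" "snd q \<in> {c<..<d}"
          using that by (simp_all only: mem_Times_iff W_def)
        moreover have "q \<in> ?D" using that sub by blast
        ultimately show ?thesis unfolding T_def using 2 p(2) by simp
      qed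
      then show ?thesis by blast
    qed
    moreover have "open W" unfolding W_def by (intro open_Times) auto
    moreover have "p \<in> W" using b by (simp add: mem_Times_iff W_def)
    ultimately show ?thesis using sub by (intro exI[of _ W]) simp
  qed
  have "open T"
  proof (subst open_subopen, intro ballI)
    fix p assume p: "p \<in> T"
    then have "\<exists>W. open W \<and> p \<in> W \<and> W \<subseteq> ?D \<and> (W \<subseteq> T \<or> W \<inter> T = {})"
      by (intro box) (auto simp: T_def rigid_def)
    then show "\<exists>W. open W \<and> p \<in> W \<and> W \<subseteq> T" using p by blast
  qed
  moreover have "open (?D - T)"
  proof (subst open_subopen, intro ballI)
    fix p assume p: "p \<in> ?D - T"
    \<comment> \<open>The continuous function \<open>?h\<close> vanishes exactly where \<open>box\<close> is applicable.\<close>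
    let ?h = "\<lambda>p. (s r (fst p) (snd p) - s\<^sub>0)\<^sup>2 + ((sin (f (snd p)))\<^sup>2 - (sin (snd p))\<^sup>2)\<^sup>2"
    show "\<exists>W. open W \<and> p \<in> W \<and> W \<subseteq> ?D - T"
    proof (cases "?h p = 0")
      case True
      then have "s r (fst p) (snd p) = s\<^sub>0" "(sin (f (snd p)))\<^sup>2 = (sin (snd p))\<^sup>2"
        by (auto simp: sum_power2_eq_zero_iff)
      then have "\<exists>W. open W \<and> p \<in> W \<and> W \<subseteq> ?D \<and> (W \<subseteq> T \<or> W \<inter> T = {})"
        using p by (intro box) auto
      then show ?thesis using p by blast
    next
      case False
      have "continuous_on ?D (\<lambda>p. f (snd p))"
        by (rule continuous_on_compose2[OF cont_f]) (auto intro!: continuous_intros)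
      moreover have "continuous_on ?D (\<lambda>p. s r (fst p) (snd p))"
        by (rule continuous_on_s[of _ "\<lambda>_. r" fst snd])
           (use r in \<open>auto intro: continuous_on_const continuous_on_fst continuous_on_snd continuous_on_id\<close>)
      ultimately have "continuous_on ?D ?h" by (intro continuous_intros)
      then have "open (?D \<inter> ?h -` (- {0}))"
        by (intro continuous_open_preimage open_Times) auto
      moreover have "?D \<inter> ?h -` (- {0}) \<subseteq> ?D - T"
        by (auto simp: T_def rigid_def)
      ultimately show ?thesis using p False by blast
    qed
  qed
  moreover have "connected ?D" by (intro connected_Times) auto
  moreover have "(\<theta>\<^sub>0, \<phi>\<^sub>0) \<in> T" using assms by (auto simp: T_def s\<^sub>0_def)
  moreover have "T \<subseteq> ?D" by (auto simp: T_def)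
  ultimately have "?D - T = {}"
    using connectedD[of ?D T "?D - T"] by blast
  moreover have "(\<theta>, \<phi>) \<in> ?D" using assms by simp
  ultimately have "(\<theta>, \<phi>) \<in> T" by blast
  then show "rigid r \<theta> \<phi>" "s r \<theta> \<phi> = s r \<theta>\<^sub>0 \<phi>\<^sub>0" by (auto simp: T_def s\<^sub>0_def)
qed

end

section \<open>Fields whose director is locally constant\<close>

text \<open>The tensor \<open>n \<otimes> n\<close>, which unlike \<open>n\<close> is a continuous function of a nonzero uniaxial tensor.\<close>

definition director_tensor :: "real^3^3 \<Rightarrow> real^3^3" where
  "director_tensor A = (1 / scalar_order A) *\<^sub>R A + (1 / 3) *\<^sub>R mat 1"

lemma director_tensor_uniaxial:
  assumes "norm n = 1" "\<sigma> \<noteq> 0"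
  shows "director_tensor (uniaxial \<sigma> n) = tensor n n"
  using assms by (simp add: director_tensor_def scalar_order_uniaxial) (simp add: uniaxial_def)

lemma continuous_on_director_tensor:
  fixes Q :: "real^3 \<Rightarrow> real^3^3"
  assumes "\<And>i j. continuous_on UNIV (\<lambda>x. Q x $ i $ j)"
    and "\<And>x. \<exists>\<sigma> n. norm n = 1 \<and> Q x = uniaxial \<sigma> n"
  shows "continuous_on {x. Q x \<noteq> 0} (\<lambda>x. director_tensor (Q x))"
proof -
  let ?O = "{x. Q x \<noteq> 0}"
  have c: "continuous_on ?O (\<lambda>x. Q x $ i $ j)" for i j
    using assms(1) continuous_on_subset by blast
  have nz: "scalar_order (Q x) \<noteq> 0 \<and> trace (Q x ** Q x) \<noteq> 0" if "x \<in> ?O" for x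
  proof -
    obtain \<sigma> n where "norm n = 1" "Q x = uniaxial \<sigma> n" using assms(2) by blast
    then show ?thesis using that by (auto simp: scalar_order_uniaxial trace_uniaxial_square uniaxial_eq_0_iff)
  qed
  have "continuous_on ?O (\<lambda>x. trace (Q x ** Q x))" "continuous_on ?O (\<lambda>x. trace (Q x ** Q x ** Q x))"
    unfolding trace_def matrix_matrix_mult_def
    by (simp_all, (intro continuous_on_sum continuous_on_mult c)+)
  then have "continuous_on ?O (\<lambda>x. scalar_order (Q x))"
    unfolding scalar_order_def using nz by (intro continuous_intros) auto
  then have "continuous_on ?O (\<lambda>x. director_tensor (Q x) $ i $ j)" for i j
    unfolding director_tensor_def using nz by (simp, intro continuous_intros c) auto
  then show ?thesis by (intro continuous_on_vecI)
qed

text \<open>Local constancy is assumed only off the plane \<open>x\<^sub>2 = 0\<close>. It extends to the plane by continuity along segments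
that start in the plane and leave it, and this makes \<open>n \<otimes> n\<close> constant on components. A director that is constant on
components is obtained by choosing a unit vector as a function of \<open>n \<otimes> n\<close>.\<close>

lemma trivial_uniaxial_if_locally_constant:
  fixes Q :: "real^3 \<Rightarrow> real^3^3"
  assumes cont: "\<And>i j. continuous_on UNIV (\<lambda>x. Q x $ i $ j)"
    and uni: "\<And>x. \<exists>\<sigma> n. norm n = 1 \<and> Q x = uniaxial \<sigma> n"
    and loc: "\<And>x. Q x \<noteq> 0 \<Longrightarrow> x $ 2 \<noteq> 0 \<Longrightarrow> \<forall>\<^sub>F y in nhds x. director_tensor (Q y) = director_tensor (Q x)"
  shows "trivial_uniaxial Q"
proof -
  let ?O = "{x. Q x \<noteq> 0}" and ?M = "\<lambda>x. director_tensor (Q x)"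
  have contM: "continuous_on ?O ?M"
    using cont uni by (rule continuous_on_director_tensor)
  have "continuous_on UNIV Q" using cont by (intro continuous_on_vecI)
  then have openO: "open ?O"
    by (intro open_Collect_neq continuous_on_const)
  have seg: "?M (p + d) = ?M p"
    if "p $ 2 = 0" "d $ 2 \<noteq> 0" and O: "\<And>\<tau>. \<tau> \<in> {0..1} \<Longrightarrow> p + \<tau> *\<^sub>R d \<in> ?O" for p d
  proof -
    let ?h = "\<lambda>\<tau>::real. ?M (p + \<tau> *\<^sub>R d)"
    have h: "?h \<tau> = ?h 1" if "\<tau> \<in> {0<..1}" for \<tau>
    proof (rule connected_local_const[where A = "{0<..1}" and f = ?h])
      show "\<forall>a\<in>{0<..1}. \<forall>\<^sub>F b in at a within {0<..1}. ?h a = ?h b"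
      proof
        fix a :: real assume a: "a \<in> {0<..1}"
        have "\<forall>\<^sub>F y in nhds (p + a *\<^sub>R d). ?M y = ?M (p + a *\<^sub>R d)"
          using a O[of a] \<open>p $ 2 = 0\<close> \<open>d $ 2 \<noteq> 0\<close> by (intro loc) auto
        moreover have "((\<lambda>\<tau>. p + \<tau> *\<^sub>R d) \<longlongrightarrow> p + a *\<^sub>R d) (at a within {0<..1})"
          by (intro tendsto_intros)
        ultimately have "\<forall>\<^sub>F b in at a within {0<..1}. ?h b = ?h a"
          using eventually_compose_filterlim by blast
        then show "\<forall>\<^sub>F b in at a within {0<..1}. ?h a = ?h b"
          by eventually_elim simp
      qed
    qed (use that in auto)
    have "continuous_on {0..1} ?h"
      using O by (intro continuous_on_compose2[OF contM] continuous_intros) auto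
    then have "?h 0 = ?h 1"
      using continuous_constant_on_closure[of "{0<..1}" ?h "?h 1" 0] h by simp
    then show ?thesis by simp
  qed
  have loc_all: "\<forall>\<^sub>F y in nhds x. ?M y = ?M x" if x: "x \<in> ?O" for x
  proof (cases "x $ 2 = 0")
    case False
    then show ?thesis using loc x by blast
  next
    case x2: True
    obtain e where e: "e > 0" "ball x e \<subseteq> ?O" using openO x open_contains_ball by blast
    have inO: "p + \<tau> *\<^sub>R (q - p) \<in> ?O" if "p \<in> ball x e" "q \<in> ball x e" "\<tau> \<in> {0..1}" for p q \<tau>
    proof -
      have "p + \<tau> *\<^sub>R (q - p) \<in> closed_segment p q"
        using that(3) unfolding in_segment by (intro exI[of _ \<tau>]) (auto simp: algebra_simps)
      then show ?thesis
        using closed_segment_subset[OF that(1,2) convex_ball] e by blast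
    qed
    have *: "?M q = ?M p" if "p \<in> ball x e" "q \<in> ball x e" "p $ 2 = 0" "q $ 2 \<noteq> 0" for p q
      using seg[of p "q - p"] inO[OF that(1,2)] that by simp
    have "?M y = ?M x" if y: "y \<in> ball x e" for y
    proof (cases "y $ 2 = 0")
      case False
      then show ?thesis using *[of x y] e y x2 by simp
    next
      case True
      \<comment> \<open>Both \<open>x\<close> and \<open>y\<close> lie in the plane; compare them through a nearby point \<open>w\<close> outside it.\<close>
      define w where "w = y + ((e - dist x y) / 2) *\<^sub>R axis 2 (1::real)"
      have "dist x w \<le> dist x y + dist y w" by (rule dist_triangle)
      also have "dist y w = (e - dist x y) / 2" using y by (simp add: w_def dist_norm)
      finally have w: "w \<in> ball x e" using y by (simp add: field_simps)
      have w2: "w $ 2 \<noteq> 0" using True y by (simp add: w_def)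
      have "?M w = ?M x" by (rule *) (use e w w2 x2 in auto)
      moreover have "?M w = ?M y" by (rule *) (use y w w2 True in auto)
      ultimately show ?thesis by metis
    qed
    moreover have "\<forall>\<^sub>F y in nhds x. y \<in> ball x e"
      using e by (intro eventually_nhds_in_open) auto
    ultimately show ?thesis by (auto elim: eventually_mono)
  qed
  define E where "E A = (SOME v. norm v = 1 \<and> tensor v v = A)" for A
  define N where "N x = (if Q x = 0 then axis 1 1 else E (?M x))" for x
  have N: "norm (N x) = 1 \<and> Q x = uniaxial (scalar_order (Q x)) (N x)" for x
  proof (cases "Q x = 0")
    case True
    then show ?thesis by (simp add: N_def scalar_order_def trace_def uniaxial_def)
  next
    case False
    obtain \<sigma> n where n: "norm n = 1" "Q x = uniaxial \<sigma> n" using uni[of x] by blast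
    then have \<sigma>: "\<sigma> \<noteq> 0" using False uniaxial_eq_0_iff[of n \<sigma>] by simp
    have "norm (E (?M x)) = 1 \<and> tensor (E (?M x)) (E (?M x)) = ?M x"
      unfolding E_def by (rule someI[of _ n]) (use n \<sigma> director_tensor_uniaxial[of n \<sigma>] in simp)
    then have v: "norm (N x) = 1" "tensor (N x) (N x) = tensor n n"
      using False n \<sigma> by (simp_all add: N_def director_tensor_uniaxial)
    have "Q x = uniaxial \<sigma> (N x)" unfolding uniaxial_def v(2) using n(2) by (simp add: uniaxial_def)
    then show ?thesis using v(1) n by (simp add: scalar_order_uniaxial)
  qed
  have "N constant_on C" if C: "C \<in> components ?O" for C
  proof -
    have CO: "C \<subseteq> ?O" and conn: "connected C"
      using C in_components_subset in_components_connected by blast+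
    have "N x = N y" if "x \<in> C" "y \<in> C" for x y
    proof -
      have "?M x = ?M y"
      proof (rule connected_local_const[OF conn that], intro ballI)
        fix a assume "a \<in> C"
        then have "\<forall>\<^sub>F b in nhds a. ?M b = ?M a" using loc_all CO by blast
        then show "\<forall>\<^sub>F b in at a within C. ?M a = ?M b"
          unfolding eventually_at_filter by eventually_elim metis
      qed
      moreover have "Q x \<noteq> 0" "Q y \<noteq> 0" using that CO by blast+
      ultimately show ?thesis unfolding N_def by simp
    qed
    then show ?thesis unfolding constant_on_def by blast
  qed
  then show ?thesis
    unfolding trivial_uniaxial_def
    by (intro exI[of _ "\<lambda>x. scalar_order (Q x)"] exI[of _ N]) (use N in blast)
qed

context separated_uniaxial
begin

text \<open>On a box where \<open>sin f\<close> vanishes identically the director is the third axis up to sign. Otherwise the dichotomy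
makes \<open>g\<close> constant, and \<open>f\<close> constant on every interval where \<open>sin f \<noteq> 0\<close>; such an interval cannot end inside the box,
because \<open>f\<close> would keep its value at the end point.\<close>

lemma tensor_locally_constant:
  assumes no_rigid: "\<And>\<theta> \<phi>. \<theta> \<in> {0<..<2 * pi} \<Longrightarrow> \<phi> \<in> {0<..<pi} \<Longrightarrow> \<not> rigid r \<theta> \<phi>"
    and dom: "0 < r" "\<theta> \<in> {0<..<2 * pi}" "\<phi> \<in> {0<..<pi}" and nz: "s r \<theta> \<phi> \<noteq> 0"
  obtains I J where "open I" "open J" "\<theta> \<in> I" "\<phi> \<in> J" "I \<subseteq> {0<..<2 * pi}" "J \<subseteq> {0<..<pi}"
    "\<And>\<theta>' \<phi>'. \<theta>' \<in> I \<Longrightarrow> \<phi>' \<in> J \<Longrightarrow>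
       tensor (direction (f \<phi>') (g \<theta>')) (direction (f \<phi>') (g \<theta>')) =
       tensor (direction (f \<phi>) (g \<theta>)) (direction (f \<phi>) (g \<theta>))"
proof -
  obtain r\<^sub>1 r\<^sub>2 a b c d where box: "0 \<le> r\<^sub>1" "r \<in> {r\<^sub>1<..<r\<^sub>2}" "\<theta> \<in> {a<..<b}" "\<phi> \<in> {c<..<d}"
    "{a<..<b} \<subseteq> {0<..<2 * pi}" "{c<..<d} \<subseteq> {0<..<pi}"
    "\<forall>r'\<in>{r\<^sub>1<..<r\<^sub>2}. \<forall>\<theta>'\<in>{a<..<b}. \<forall>\<phi>'\<in>{c<..<d}. s r' \<theta>' \<phi>' \<noteq> 0"
    by (rule nonzero_box[OF dom(1,2,3) open_greaterThanLessThan order_refl nz])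
  let ?I = "{a<..<b}" and ?J = "{c<..<d}"
  have cf: "continuous_on ?J f" using cont_f by (rule continuous_on_subset) (use box in auto)
  have "tensor (direction (f \<phi>') (g \<theta>')) (direction (f \<phi>') (g \<theta>')) =
       tensor (direction (f \<phi>) (g \<theta>)) (direction (f \<phi>) (g \<theta>))" if in_box: "\<theta>' \<in> ?I" "\<phi>' \<in> ?J" for \<theta>' \<phi>'
  proof (cases "\<exists>\<phi>\<^sub>1\<in>?J. sin (f \<phi>\<^sub>1) \<noteq> 0")
    case False
    have "tensor (direction (f x) y) (direction (f x) y) = tensor (axis 3 1) (axis 3 1)"
      if "x \<in> ?J" for x y
    proof -
      have s0: "sin (f x) = 0" using False that by blast
      then have "cos (f x) * cos (f x) = 1"
        using sin_cos_squared_add[of "f x"] by (simp add: power2_eq_square)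
      with s0 show ?thesis
        by (simp add: tensor_def direction_def vec_eq_iff forall_3 axis_def)
    qed
    then show ?thesis using in_box box(4) by metis
  next
    case True
    then obtain \<phi>\<^sub>1 where p1: "\<phi>\<^sub>1 \<in> ?J" "sin (f \<phi>\<^sub>1) \<noteq> 0" by blast
    have sub: "\<exists>W. open W \<and> \<phi>' \<in> W \<and> W \<subseteq> ?J \<and> (\<forall>x\<in>W. f x = f \<phi>') \<and> (\<forall>x\<in>?I. \<forall>y\<in>?I. g x = g y)"
      if p: "\<phi>' \<in> ?J" "sin (f \<phi>') \<noteq> 0" for \<phi>'
    proof -
      have "open (?J \<inter> (\<lambda>\<phi>. sin (f \<phi>)) -` (- {0}))"
        by (intro continuous_open_preimage continuous_on_sin cf) auto
      then obtain c' d' where J': "\<phi>' \<in> {c'<..<d'}" "{c'<..<d'} \<subseteq> ?J \<inter> (\<lambda>\<phi>. sin (f \<phi>)) -` (- {0})"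
        by (rule open_real_interval) (use p in auto)
      have lt: "r\<^sub>1 < r\<^sub>2" "a < b" "c' < d'" using box J'(1) by auto
      have J'pi: "{c'<..<d'} \<subseteq> {0<..<pi}" using J'(2) box(6) by blast
      have nz': "\<forall>r'\<in>{r\<^sub>1<..<r\<^sub>2}. \<forall>\<theta>'\<in>?I. \<forall>\<phi>'\<in>{c'<..<d'}. s r' \<theta>' \<phi>' \<noteq> 0"
        using box(7) J'(2) by blast
      have sf': "\<forall>x\<in>{c'<..<d'}. sin (f x) \<noteq> 0" using J'(2) by blast
      have "(\<forall>x\<in>?I. \<forall>y\<in>?I. g x = g y) \<and> (\<forall>x\<in>{c'<..<d'}. \<forall>y\<in>{c'<..<d'}. f x = f y)"
      proof (rule ccontr)
        assume "\<not> ?thesis"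
        then obtain \<kappa> \<gamma> where "\<kappa>\<^sup>2 = 1" "\<gamma>\<^sup>2 = 1"
          "\<forall>\<phi>\<in>{c'<..<d'}. jet2 f \<phi> \<kappa> 0 \<and> (sin (f \<phi>))\<^sup>2 = (sin \<phi>)\<^sup>2" "\<forall>\<theta>\<in>?I. jet2 g \<theta> \<gamma> 0"
          using box_dichotomy[OF box(1) lt box(5) J'pi nz' sf'] by (elim disjE conjE exE) blast+
        then have "rigid r \<theta> \<phi>'"
          unfolding rigid_def using nz' box(2,3) J'(1) by blast
        then show False using no_rigid dom(2) J'pi J'(1) by blast
      qed
      then have g: "\<forall>x\<in>?I. \<forall>y\<in>?I. g x = g y" and f: "\<forall>x\<in>{c'<..<d'}. f x = f \<phi>'"
        using J'(1) by blast+
      have "{c'<..<d'} \<subseteq> ?J" using J'(2) by blast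
      with f g J'(1) show ?thesis
        by (intro exI[of _ "{c'<..<d'}"] conjI open_greaterThanLessThan)
    qed
    have "\<forall>x\<in>?I. \<forall>y\<in>?I. g x = g y" using sub[OF p1] by (elim exE conjE)
    then have g: "g \<theta>' = g \<theta>" using in_box(1) box(3) by blast
    have f_const: "f x = f \<phi>\<^sub>1" if "x \<in> ?J" for x
    proof -
      define T where "T = {x \<in> ?J. f x = f \<phi>\<^sub>1}"
      have "open T"
        unfolding T_def
      proof (subst open_subopen, intro ballI)
        fix x assume "x \<in> {x \<in> ?J. f x = f \<phi>\<^sub>1}"
        then have x: "x \<in> ?J" "f x = f \<phi>\<^sub>1" by auto
        then have "sin (f x) \<noteq> 0" using p1 by simp
        from sub[OF x(1) this] obtain W where "open W" "x \<in> W" "W \<subseteq> ?J" "\<forall>y\<in>W. f y = f x"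
          by (elim exE conjE)
        then show "\<exists>W. open W \<and> x \<in> W \<and> W \<subseteq> {x \<in> ?J. f x = f \<phi>\<^sub>1}"
          using x(2) by (intro exI[of _ W]) auto
      qed
      moreover have "open (?J \<inter> f -` (- {f \<phi>\<^sub>1}))"
        by (intro continuous_open_preimage cf) auto
      moreover have "connected ?J" by simp
      moreover have "\<phi>\<^sub>1 \<in> T" using p1 by (simp add: T_def)
      moreover have "T \<inter> (?J \<inter> f -` (- {f \<phi>\<^sub>1})) \<inter> ?J = {}" "?J \<subseteq> T \<union> (?J \<inter> f -` (- {f \<phi>\<^sub>1}))"
        by (auto simp: T_def)
      ultimately have "(?J \<inter> f -` (- {f \<phi>\<^sub>1})) \<inter> ?J = {}"
        using connectedD[of ?J T "?J \<inter> f -` (- {f \<phi>\<^sub>1})"] p1 by blast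
      then show ?thesis using that by blast
    qed
    have "f \<phi>' = f \<phi>" using f_const[OF in_box(2)] f_const[OF box(4)] by simp
    with g show ?thesis by simp
  qed
  then show ?thesis
    by (rule that[OF open_greaterThanLessThan open_greaterThanLessThan box(3-6)])
qed

lemma uniaxial_everywhere: "\<exists>\<sigma> n. norm n = 1 \<and> Q x = uniaxial \<sigma> n"
  using Q_spherical[of "norm x" "azimuth x" "polar_angle x"] spherical_coordinates[of x] norm_direction
  by (metis norm_ge_zero)

lemma trivial_if_not_rigid:
  assumes "\<And>r \<theta> \<phi>. 0 < r \<Longrightarrow> \<theta> \<in> {0<..<2 * pi} \<Longrightarrow> \<phi> \<in> {0<..<pi} \<Longrightarrow> \<not> rigid r \<theta> \<phi>"
  shows "trivial_uniaxial Q"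
proof (rule trivial_uniaxial_if_locally_constant[OF continuous_Q_nth uniaxial_everywhere])
  fix x :: "real^3" assume x: "Q x \<noteq> 0" "x $ 2 \<noteq> 0"
  let ?t = "\<lambda>\<theta> \<phi>. tensor (direction (f \<phi>) (g \<theta>)) (direction (f \<phi>) (g \<theta>))"
  note xi = spherical_coordinates_interior[OF x(2)]
  have Q: "Q y = uniaxial (s (norm y) (azimuth y) (polar_angle y)) (direction (f (polar_angle y)) (g (azimuth y)))" for y
    using Q_spherical[OF norm_ge_zero spherical_coordinates(1,2), of y y y]
    unfolding spherical_coordinates(3) .
  have dt: "director_tensor (Q y) = ?t (azimuth y) (polar_angle y)" if "Q y \<noteq> 0" for y
    using that by (subst Q, intro director_tensor_uniaxial norm_direction)
      (use Q[of y] uniaxial_eq_0_iff[OF norm_direction] in metis)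
  have "s (norm x) (azimuth x) (polar_angle x) \<noteq> 0"
    using x(1) Q[of x] uniaxial_eq_0_iff[OF norm_direction] by metis
  then obtain I J where IJ: "open I" "open J" "azimuth x \<in> I" "polar_angle x \<in> J"
    "\<And>\<theta>' \<phi>'. \<theta>' \<in> I \<Longrightarrow> \<phi>' \<in> J \<Longrightarrow> ?t \<theta>' \<phi>' = ?t (azimuth x) (polar_angle x)"
    using tensor_locally_constant[OF assms[OF xi(1)] xi] by metis
  have "(azimuth \<longlongrightarrow> azimuth x) (nhds x)" "(polar_angle \<longlongrightarrow> polar_angle x) (nhds x)"
    using isCont_spherical_coordinates[OF x(2)]
    by (simp_all add: isCont_def tendsto_at_iff_tendsto_nhds)
  then have "\<forall>\<^sub>F y in nhds x. azimuth y \<in> I" "\<forall>\<^sub>F y in nhds x. polar_angle y \<in> J"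
    using topological_tendstoD IJ(1-4) by blast+
  moreover have "\<forall>\<^sub>F y in nhds x. Q y \<noteq> 0"
    using eventually_nhds_in_open[OF open_Collect_neq[OF continuous_Q continuous_on_const], of x 0] x(1)
    by simp
  ultimately show "\<forall>\<^sub>F y in nhds x. director_tensor (Q y) = director_tensor (Q x)"
    by eventually_elim (use dt x(1) IJ(5) in metis)
qed

end

section \<open>The hedgehog and its radial equation\<close>

context separated_uniaxial
begin

text \<open>Once the angles are known on one sphere they are known on all of them, so every interior point with \<open>s \<noteq> 0\<close> is rigid and
\<open>s\<close> is constant on every open coordinate rectangle. The closed edges of the rectangle and the origin follow by
continuity; \<open>(pi, pi / 2)\<close> is an arbitrary interior reference point.\<close>

lemma s_radial:
  assumes f: "\<And>\<phi>. \<phi> \<in> {0<..<pi} \<Longrightarrow> (sin (f \<phi>))\<^sup>2 = (sin \<phi>)\<^sup>2 \<and> (\<exists>\<kappa>. \<kappa>\<^sup>2 = 1 \<and> jet2 f \<phi> \<kappa> 0)"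
    and g: "\<And>\<theta>. \<theta> \<in> {0<..<2 * pi} \<Longrightarrow> \<exists>\<gamma>. \<gamma>\<^sup>2 = 1 \<and> jet2 g \<theta> \<gamma> 0"
    and dom: "0 \<le> r" "\<theta> \<in> {0..<2 * pi}" "\<phi> \<in> {0..pi}"
  shows "s r \<theta> \<phi> = s r pi (pi / 2)"
proof -
  have interior: "s r \<theta> \<phi> = s r pi (pi / 2)"
    if "0 < r" "\<theta> \<in> {0<..<2 * pi}" "\<phi> \<in> {0<..<pi}" for r \<theta> \<phi>
  proof -
    have m: "pi \<in> {0<..<2 * pi}" "pi / 2 \<in> {0<..<pi}" by auto
    have rigid: "rigid r \<theta> \<phi>" if "\<theta> \<in> {0<..<2 * pi}" "\<phi> \<in> {0<..<pi}" "s r \<theta> \<phi> \<noteq> 0" for \<theta> \<phi>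
      unfolding rigid_def using f g that by blast
    show ?thesis
      using rigid_everywhere(2)[OF that(1) m rigid[OF m] that(2,3)]
        rigid_everywhere(2)[OF that rigid[OF that(2,3)] m] by metis
  qed
  have angular: "s r \<theta> \<phi> = s r pi (pi / 2)" if r: "0 < r" and "\<theta> \<in> {0..<2 * pi}" "\<phi> \<in> {0..pi}" for r \<theta> \<phi>
  proof -
    \<comment> \<open>The rectangle is cut off at some \<open>b < 2 \<pi>\<close>, where \<open>g\<close> is still continuous.\<close>
    define b where "b = (\<theta> + 2 * pi) / 2"
    have b: "0 < b" "\<theta> \<le> b" "b < 2 * pi" using that by (auto simp: b_def)
    let ?S = "{0<..<b} \<times> {0<..<pi}"
    have cl: "closure ?S = {0..b} \<times> {0..pi}" using b by (simp add: closure_Times)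
    have "continuous_on (closure ?S) (\<lambda>p. s r (fst p) (snd p))"
      unfolding cl
      by (rule continuous_on_s[of _ "\<lambda>_. r" fst snd])
         (use r b in \<open>auto intro: continuous_on_const continuous_on_fst continuous_on_snd continuous_on_id\<close>)
    then have "(\<lambda>p. s r (fst p) (snd p)) (\<theta>, \<phi>) = s r pi (pi / 2)"
    proof (rule continuous_constant_on_closure)
      show "s r (fst p) (snd p) = s r pi (pi / 2)" if "p \<in> ?S" for p
        using that b by (intro interior r) auto
      show "(\<theta>, \<phi>) \<in> closure ?S" unfolding cl using that b by simp
    qed
    then show ?thesis by simp
  qed
  show ?thesis
  proof (cases "r = 0")
    case True
    let ?h = "\<lambda>r. s r \<theta> \<phi> - s r pi (pi / 2)"
    have cs: "continuous_on {0..1} (\<lambda>r. s r \<theta> \<phi>)" if "\<theta> \<in> {0..<2 * pi}" "\<phi> \<in> {0..pi}" for \<theta> \<phi>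
      by (rule continuous_on_s[of _ "\<lambda>r. r" "\<lambda>_. \<theta>" "\<lambda>_. \<phi>"])
         (use that in \<open>auto intro: continuous_on_const continuous_on_id\<close>)
    have "continuous_on {0..1} ?h"
      by (intro continuous_on_diff cs) (use dom in auto)
    then have "?h 0 = 0"
      using continuous_constant_on_closure[of "{0<..1}" ?h 0 0] angular[OF _ dom(2,3)] by simp
    then show ?thesis using True by simp
  qed (use angular[OF _ dom(2,3)] dom(1) in simp)
qed

text \<open>The \<open>(e, e)\<close> equation at \<open>\<theta> = \<pi>\<close>, \<open>\<phi> = \<pi> / 2\<close>, with all angular derivatives of \<open>s\<close> zero. The formula
\<open>s = (3/2) n \<bullet> Q n\<close> makes \<open>S\<close> twice differentiable also at its zeros.\<close>

lemma radial_equation: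
  assumes f: "\<And>\<phi>. \<phi> \<in> {0<..<pi} \<Longrightarrow> \<exists>\<kappa>. \<kappa>\<^sup>2 = 1 \<and> jet2 f \<phi> \<kappa> 0"
    and g: "\<And>\<theta>. \<theta> \<in> {0<..<2 * pi} \<Longrightarrow> \<exists>\<gamma>. \<gamma>\<^sup>2 = 1 \<and> jet2 g \<theta> \<gamma> 0"
    and S: "\<And>r \<theta> \<phi>. 0 \<le> r \<Longrightarrow> \<theta> \<in> {0..<2 * pi} \<Longrightarrow> \<phi> \<in> {0..pi} \<Longrightarrow> s r \<theta> \<phi> = S r"
    and r: "0 < r"
  shows "S differentiable at r" "deriv S differentiable at r"
    and "deriv (deriv S) r + 2 / r * deriv S r =
         6 / r\<^sup>2 * S r + t * S r - sqrt 6 * (S r)\<^sup>2 + 4 / 3 * (S r)^3"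
proof -
  have m: "pi \<in> {0<..<2 * pi}" "pi / 2 \<in> {0<..<pi}" by auto
  let ?n = "direction (f (pi / 2)) (g pi)"
  have "twice (\<lambda>\<rho>. 3 / 2 * (?n \<bullet> (Q (spherical \<rho> pi (pi / 2)) *v ?n))) r"
    unfolding inner_matrix_vector by (intro twice_mult twice_sum twice_const Q_line_twice) auto
  moreover have ev: "\<forall>\<^sub>F \<rho> in nhds r. \<rho> \<in> {0<..}" using r by (intro eventually_nhds_in_open) auto
  then have "\<forall>\<^sub>F \<rho> in nhds r. S \<rho> = 3 / 2 * (?n \<bullet> (Q (spherical \<rho> pi (pi / 2)) *v ?n))"
    by eventually_elim (use S[of _ pi "pi / 2"] s_eq_contraction[of _ pi "pi / 2"] in simp)
  ultimately have jS: "jet2 S r (deriv S r) (deriv (deriv S) r)"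
    by (intro twice_jet2 twice_cong[of _ r S])
  then show "S differentiable at r" "deriv S differentiable at r"
    using jet2D jet2_deriv(2) real_differentiable_def by blast+
  have 1: "jet2 (\<lambda>\<rho>. s \<rho> pi (pi / 2)) r (deriv S r) (deriv (deriv S) r)"
    by (rule jet2_cong[OF jS]) (use ev in \<open>eventually_elim\<close>, use S in simp)
  have 2: "jet2 (\<lambda>\<theta>. s r \<theta> (pi / 2)) pi 0 0"
    by (rule jet2_cong[OF jet2_const[of "S r"]])
       (use eventually_nhds_in_open[OF open_greaterThanLessThan m(1)] in \<open>eventually_elim\<close>, use S r in simp)
  have 3: "jet2 (\<lambda>\<phi>. s r pi \<phi>) (pi / 2) 0 0"
    by (rule jet2_cong[OF jet2_const[of "S r"]])
       (use eventually_nhds_in_open[OF open_greaterThanLessThan m(2)] in \<open>eventually_elim\<close>, use S r in simp)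
  obtain \<kappa> where \<kappa>: "\<kappa>\<^sup>2 = 1" "jet2 f (pi / 2) \<kappa> 0" using f m by blast
  obtain \<gamma> where \<gamma>: "\<gamma>\<^sup>2 = 1" "jet2 g pi \<gamma> 0" using g m by blast
  have eq: "r\<^sup>2 * deriv (deriv S) r + 2 * r * deriv S r - r\<^sup>2 * bulk t (S r) = 6 * S r"
    using frame_equations(1)[OF r m 1 2 3 \<kappa>(2) \<gamma>(2)] \<kappa>(1) S[of r pi "pi / 2"] r by simp
  have "deriv (deriv S) r + 2 / r * deriv S r - bulk t (S r) =
      (r\<^sup>2 * deriv (deriv S) r + 2 * r * deriv S r - r\<^sup>2 * bulk t (S r)) / r\<^sup>2"
    using r by (simp add: add_divide_distrib diff_divide_distrib power2_eq_square)
  also have "\<dots> = 6 / r\<^sup>2 * S r" unfolding eq by simp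
  finally show "deriv (deriv S) r + 2 / r * deriv S r =
         6 / r\<^sup>2 * S r + t * S r - sqrt 6 * (S r)\<^sup>2 + 4 / 3 * (S r)^3"
    by (simp add: bulk_def)
qed

text \<open>The slope comes from the jets and the offset from the pole: at \<open>\<phi> = 0\<close> the identity \<open>sin\<^sup>2 f = sin\<^sup>2 \<phi>\<close>
forces \<open>f 0\<close> to be a multiple of \<open>\<pi>\<close>.\<close>

lemma polar_angle_affine:
  assumes f: "\<And>\<phi>. \<phi> \<in> {0<..<pi} \<Longrightarrow> (sin (f \<phi>))\<^sup>2 = (sin \<phi>)\<^sup>2 \<and> (\<exists>\<kappa>. \<kappa>\<^sup>2 = 1 \<and> jet2 f \<phi> \<kappa> 0)"
  shows "\<exists>m::int. (\<forall>\<phi>\<in>{0..pi}. f \<phi> = \<phi> + of_int m * pi) \<or> (\<forall>\<phi>\<in>{0..pi}. f \<phi> = - \<phi> + of_int m * pi)"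
proof -
  obtain \<kappa> c where \<kappa>: "\<kappa> = 1 \<or> \<kappa> = - 1" and c: "\<And>\<phi>. \<phi> \<in> {0<..<pi} \<Longrightarrow> f \<phi> = \<kappa> * \<phi> + c"
    by (rule affine_if_jet_unit_slope[of 0 pi f]) (use f in auto)
  have cl: "closure {0<..<pi} = {0..pi}" by simp
  have affine: "f \<phi> = \<kappa> * \<phi> + c" if "\<phi> \<in> {0..pi}" for \<phi>
  proof -
    have "(\<lambda>\<phi>. f \<phi> - \<kappa> * \<phi>) \<phi> = c"
      by (rule continuous_constant_on_closure[of "{0<..<pi}"])
         (use that c cl in \<open>auto intro!: continuous_intros cont_f\<close>)
    then show ?thesis by simp
  qed
  have "(\<lambda>\<phi>. (sin (f \<phi>))\<^sup>2 - (sin \<phi>)\<^sup>2) 0 = 0"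
    by (rule continuous_constant_on_closure[of "{0<..<pi}"])
       (use f cl in \<open>auto intro!: continuous_intros cont_f\<close>)
  then have "sin c = 0" using affine[of 0] by simp
  then obtain m :: int where "c = of_int m * pi" using sin_zero_iff_int2 by blast
  then show ?thesis using \<kappa> affine by auto
qed

lemma azimuth_derivative:
  assumes g: "\<And>\<theta>. \<theta> \<in> {0<..<2 * pi} \<Longrightarrow> \<exists>\<gamma>. \<gamma>\<^sup>2 = 1 \<and> jet2 g \<theta> \<gamma> 0"
  shows "(\<forall>\<theta>\<in>{0..<2 * pi}. (g has_real_derivative 1) (at \<theta> within {0..<2 * pi})) \<or>
         (\<forall>\<theta>\<in>{0..<2 * pi}. (g has_real_derivative - 1) (at \<theta> within {0..<2 * pi}))"
proof -
  obtain \<gamma> c where \<gamma>: "\<gamma> = 1 \<or> \<gamma> = - 1" and c: "\<And>\<theta>. \<theta> \<in> {0<..<2 * pi} \<Longrightarrow> g \<theta> = \<gamma> * \<theta> + c"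
    by (rule affine_if_jet_unit_slope[of 0 "2 * pi" g]) (use g in auto)
  have sub: "{0..pi} \<subseteq> {0..<2 * pi}"
    using pi_gt_zero unfolding subset_iff atLeastAtMost_iff atLeastLessThan_iff by linarith
  have "(\<lambda>\<theta>. g \<theta> - \<gamma> * \<theta>) 0 = c"
    by (rule continuous_constant_on_closure[of "{0<..<pi}" "\<lambda>\<theta>. g \<theta> - \<gamma> * \<theta>"])
       (use c in \<open>auto intro!: continuous_intros continuous_on_subset[OF cont_g sub]\<close>)
  then have affine: "g \<theta> = \<gamma> * \<theta> + c" if "\<theta> \<in> {0..<2 * pi}" for \<theta>
    using c that by (cases "\<theta> = 0") auto
  have "(g has_real_derivative \<gamma>) (at \<theta> within {0..<2 * pi})" if "\<theta> \<in> {0..<2 * pi}" for \<theta>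
  proof (rule has_field_derivative_transform_within[of "\<lambda>\<theta>. \<gamma> * \<theta> + c" _ _ _ 1])
    show "((\<lambda>\<theta>. \<gamma> * \<theta> + c) has_real_derivative \<gamma>) (at \<theta> within {0..<2 * pi})"
      by (auto intro!: derivative_eq_intros)
  qed (use that affine in auto)
  then show ?thesis using \<gamma> by blast
qed

end

theorem proposition3p1:
  fixes t :: real
    and Q :: "real^3 \<Rightarrow> real^3^3"
    and s :: "real \<Rightarrow> real \<Rightarrow> real \<Rightarrow> real"
    and n :: "real \<Rightarrow> real \<Rightarrow> real^3"
    and f g :: "real \<Rightarrow> real"
  assumes "t \<le> 1"
    and "EL_solution t Q"
    and "\<not> trivial_uniaxial Q"
    and "\<And>r \<theta> \<phi>. 0 \<le> r \<Longrightarrow> \<theta> \<in> {0..<2 * pi} \<Longrightarrow> \<phi> \<in> {0..pi} \<Longrightarrow>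
           Q (spherical r \<theta> \<phi>) = uniaxial (s r \<theta> \<phi>) (n \<theta> \<phi>)"
    and "\<And>\<theta> \<phi>. \<theta> \<in> {0..<2 * pi} \<Longrightarrow> \<phi> \<in> {0..pi} \<Longrightarrow>
           n \<theta> \<phi> = vector [sin (f \<phi>) * cos (g \<theta>), sin (f \<phi>) * sin (g \<theta>), cos (f \<phi>)]"
    and "continuous_on {0..pi} f"
    and "continuous_on {0..<2 * pi} g"
  shows "(\<exists>m::int. (\<forall>\<phi>\<in>{0..pi}. f \<phi> = \<phi> + of_int m * pi) \<or>
                   (\<forall>\<phi>\<in>{0..pi}. f \<phi> = - \<phi> + of_int m * pi)) \<and>
         ((\<forall>\<theta>\<in>{0..<2 * pi}. (g has_real_derivative 1) (at \<theta> within {0..<2 * pi})) \<or>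
          (\<forall>\<theta>\<in>{0..<2 * pi}. (g has_real_derivative - 1) (at \<theta> within {0..<2 * pi}))) \<and>
         (\<exists>S. (\<forall>r \<theta> \<phi>. 0 \<le> r \<longrightarrow> \<theta> \<in> {0..<2 * pi} \<longrightarrow> \<phi> \<in> {0..pi} \<longrightarrow> s r \<theta> \<phi> = S r) \<and>
              (\<forall>r>0. S differentiable at r \<and> deriv S differentiable at r \<and>
                 deriv (deriv S) r + 2 / r * deriv S r =
                   6 / r^2 * S r + t * S r - sqrt 6 * (S r)^2 + 4/3 * (S r)^3))"
proof -
  have "separated_uniaxial t Q s f g"
    by unfold_locales (use assms in \<open>simp_all add: direction_def\<close>)
  then interpret separated_uniaxial t Q s f g .
  obtain r \<theta>\<^sub>0 \<phi>\<^sub>0 where 0: "0 < r" "\<theta>\<^sub>0 \<in> {0<..<2 * pi}" "\<phi>\<^sub>0 \<in> {0<..<pi}" "rigid r \<theta>\<^sub>0 \<phi>\<^sub>0"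
    using trivial_if_not_rigid assms(3) by blast
  have rigid: "rigid r \<theta> \<phi>" if "\<theta> \<in> {0<..<2 * pi}" "\<phi> \<in> {0<..<pi}" for \<theta> \<phi>
    using rigid_everywhere(1)[OF 0 that] .
  have f: "(sin (f \<phi>))\<^sup>2 = (sin \<phi>)\<^sup>2 \<and> (\<exists>\<kappa>. \<kappa>\<^sup>2 = 1 \<and> jet2 f \<phi> \<kappa> 0)" if "\<phi> \<in> {0<..<pi}" for \<phi>
    using rigid[OF 0(2) that] unfolding rigid_def by blast
  have g: "\<exists>\<gamma>. \<gamma>\<^sup>2 = 1 \<and> jet2 g \<theta> \<gamma> 0" if "\<theta> \<in> {0<..<2 * pi}" for \<theta>
    using rigid[OF that 0(3)] unfolding rigid_def by blast
  have f': "\<exists>\<kappa>. \<kappa>\<^sup>2 = 1 \<and> jet2 f \<phi> \<kappa> 0" if "\<phi> \<in> {0<..<pi}" for \<phi>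
    using f[OF that] by blast
  define S where "S \<rho> = s \<rho> pi (pi / 2)" for \<rho>
  have S: "s \<rho> \<theta> \<phi> = S \<rho>" if "0 \<le> \<rho>" "\<theta> \<in> {0..<2 * pi}" "\<phi> \<in> {0..pi}" for \<rho> \<theta> \<phi>
    unfolding S_def using s_radial[OF f g that] .
  show ?thesis
    using polar_angle_affine[OF f] azimuth_derivative[OF g]
  proof (intro conjI exI[of _ S] allI impI)
    fix \<rho> :: real assume "0 < \<rho>"
    note radial = radial_equation[OF f' g S this]
    show "S differentiable at \<rho>" by (rule radial(1))
    show "deriv S differentiable at \<rho>" by (rule radial(2))
    show "deriv (deriv S) \<rho> + 2 / \<rho> * deriv S \<rho> =
        6 / \<rho>\<^sup>2 * S \<rho> + t * S \<rho> - sqrt 6 * (S \<rho>)\<^sup>2 + 4/3 * (S \<rho>)^3"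
      by (rule radial(3))
  qed (use S in auto)
qed

end
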